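(* Let $X=\mathbb{R}^d$ and $\mathcal F=\mathscr H+\mathcal E_G-\mathcal E_H$ on $\mathcal P_2(X)$, and suppose the standing assumptions (i)--(iv) of the context hold with constant $\eta_0>0$. Let $S:X\to X$ be a Borel measurable selector of the convex subdifferential $\partial H$, i.e. $S(x)\in\partial H(x)$ for all $x\in X$. Let $0<\eta<\eta_0$, let $\mu_0\in\mathcal P_{2,\mathrm{abs}}(X)$, and let $(\mu_n)_{n\ge 0}$ be a sequence produced by the semi Forward-Backward Euler scheme $$\nu_{n+1}=(I+\eta S)_{\#}\mu_n,\qquad \mu_{n+1}\in \mathrm{JKO}_{\eta(\mathcal E_G+\mathscr H)}(\nu_{n+1}),\qquad n\ge 0.$$ Then, as $N\to\infty$, $$\min_{1\le n\le N}\|\mathcal G_\eta(\mu_n)\|^2_{L^2(X,X,\mu_n)}=O(N^{-1}),$$ where $\mathcal G_\eta$ is the Wasserstein (sub)gradient mapping $\mathcal G_\eta(\mu):=\frac1\eta\Big(I-T_\mu^{\mathrm{JKO}_{\eta(\mathcal E_G+\mathscr H)}((I+\eta S)_\#\mu)}\Big)$.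
   Context: $X=\mathbb R^d$. $\mathcal P_2(X)$ is the set of Borel probability measures on $X$ with finite second moment, $W_2$ the 2-Wasserstein distance on it, and $\mathcal P_{2,\mathrm{abs}}(X)\subset\mathcal P_2(X)$ the subset of measures absolutely continuous with respect to Lebesgue measure. For $\mu\in\mathcal P_{2,\mathrm{abs}}(X)$ and $\nu\in\mathcal P_2(X)$, $T_\mu^\nu$ is the ($\mu$-a.e. unique) optimal transport map from $\mu$ to $\nu$ for the cost $\|x-y\|^2$. $T_\#\mu$ is the pushforward, $I$ the identity map, and $\|\xi\|_{L^2(X,X,\mu)}=(\int\|\xi\|^2d\mu)^{1/2}$. A function $f:X\to\mathbb R$ has quadratic growth if there is $a>0$ with $|f(x)|\le a(\|x\|^2+1)$ for all $x$. For such $f$, $\mathcal E_f(\mu):=\int f\,d\mu$ for $\mu\in\mathcal P_2(X)$. For $\phi:\mathcal P_2(X)\to\mathbb R\cup\{+\infty\}$: $\mathrm{dom}(\phi)=\{\mu:\phi(\mu)<+\infty\}$; $\phi$ is proper if $\mathrm{dom}(\phi)\ne\emptyset$; $\phi$ is l.s.c. if $\liminf_n\phi(\mu_n)\ge\phi(\mu)$ whenever $W_2(\mu_n,\mu)\to0$; $\phi$ is convex along generalized geodesics if for all $\mu,\pi\in\mathcal P_2(X)$, $\nu\in\mathcal P_{2,\mathrm{abs}}(X)$, $t\in[0,1]$, $\phi((tT_\nu^\mu+(1-t)T_\nu^\pi)_\#\nu)\le t\phi(\mu)+(1-t)\phi(\pi)$. JKO operator: $\mathrm{JKO}_{\eta\phi}(\mu):=\arg\min_{\nu\in\mathcal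 P_2(X)}\phi(\nu)+\frac1{2\eta}W_2^2(\mu,\nu)$ (set of minimizers). Where $\mathrm{JKO}$ is used as a measure (in $\mathcal G_\eta$), it denotes the minimizer; along the scheme this is the minimizer $\mu_{n+1}$ used in the scheme, so $\mathcal G_\eta(\mu_n)=\frac1\eta(I-T_{\mu_n}^{\mu_{n+1}})$. Standing assumptions: $F=G-H$ and $\mathcal F(\mu)=\mathcal E_F(\mu)+\mathscr H(\mu)=\mathcal E_G(\mu)-\mathcal E_H(\mu)+\mathscr H(\mu)$, where (i) $\mathcal F$ is bounded below; (ii) $G,H:X\to\mathbb R$ are convex and have quadratic growth; (iii) $\mathscr H:\mathcal P_2(X)\to\mathbb R\cup\{+\infty\}$ is proper, l.s.c., convex along generalized geodesics, and $\mathrm{dom}(\mathscr H)\subset\mathcal P_{2,\mathrm{abs}}(X)$; (iv) there is $\eta_0>0$ such that for all $\eta\in(0,\eta_0)$ and all $\mu\in\mathcal P_2(X)$, $\mathrm{JKO}_{\eta(\mathcal E_G+\mathscr H)}(\mu)\neq\emptyset$. *)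

theory Defs
  imports "HOL-Probability.Probability" "HOL-Library.Landau_Symbols"
begin

subsection \<open>Wasserstein space\<close>

definition P2 :: "'a::euclidean_space measure set" where
  "P2 = {\<mu>. prob_space \<mu> \<and> sets \<mu> = sets borel \<and> integrable \<mu> (\<lambda>x. (norm x)\<^sup>2)}"

definition P2abs :: "'a::euclidean_space measure set" where
  "P2abs = {\<mu> \<in> P2. absolutely_continuous lborel \<mu>}"

definition couplings ::
    "'a::euclidean_space measure \<Rightarrow> 'a measure \<Rightarrow> ('a \<times> 'a) measure set" where
  "couplings \<mu> \<nu> = {\<gamma>. prob_space \<gamma> \<and> sets \<gamma> = sets (borel \<Otimes>\<^sub>M borel) \<and>
      distr \<gamma> borel fst = \<mu> \<and> distr \<gamma> borel snd = \<nu>}"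

text \<open>Couplings of measures in \<open>P2\<close> have integrable quadratic cost and always exist (the
  product measure), so on \<open>P2\<close> the Bochner integral and the real-valued infimum
  below are the genuine ones.\<close>

definition transport_cost :: "('a::euclidean_space \<times> 'a) measure \<Rightarrow> real" where
  "transport_cost \<gamma> = (\<integral>z. (norm (fst z - snd z))\<^sup>2 \<partial>\<gamma>)"

definition W2 :: "'a::euclidean_space measure \<Rightarrow> 'a measure \<Rightarrow> real" where
  "W2 \<mu> \<nu> = sqrt (INF \<gamma>\<in>couplings \<mu> \<nu>. transport_cost \<gamma>)"

definition optimal_plans ::
    "'a::euclidean_space measure \<Rightarrow> 'a measure \<Rightarrow> ('a \<times> 'a) measure set" where
  "optimal_plans \<mu> \<nu> = {\<gamma>. is_arg_min transport_cost (\<lambda>\<gamma>. \<gamma> \<in> couplings \<mu> \<nu>) \<gamma>}"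

definition is_optimal_map ::
    "'a::euclidean_space measure \<Rightarrow> 'a measure \<Rightarrow> ('a \<Rightarrow> 'a) \<Rightarrow> bool" where
  "is_optimal_map \<mu> \<nu> T \<longleftrightarrow> T \<in> borel_measurable borel \<and> distr \<mu> borel T = \<nu> \<and>
      distr \<mu> (borel \<Otimes>\<^sub>M borel) (\<lambda>x. (x, T x)) \<in> optimal_plans \<mu> \<nu>"

text \<open>By Brenier's theorem an optimal map exists and is \<open>\<mu>\<close>-a.e. unique when
  \<open>\<mu> \<in> P2abs\<close> and \<open>\<nu> \<in> P2\<close>; the choice operator only selects a version of it.\<close>

definition optimal_map ::
    "'a::euclidean_space measure \<Rightarrow> 'a measure \<Rightarrow> 'a \<Rightarrow> 'a" where
  "optimal_map \<mu> \<nu> = (SOME T. is_optimal_map \<mu> \<nu> T)"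

definition L2_norm_wrt :: "'a::euclidean_space measure \<Rightarrow> ('a \<Rightarrow> 'a) \<Rightarrow> real" where
  "L2_norm_wrt \<mu> \<xi> = sqrt (\<integral>x. (norm (\<xi> x))\<^sup>2 \<partial>\<mu>)"


subsection \<open>Functions on the base space\<close>

definition quadratic_growth :: "('a::euclidean_space \<Rightarrow> real) \<Rightarrow> bool" where
  "quadratic_growth f \<longleftrightarrow> (\<exists>a>0. \<forall>x. \<bar>f x\<bar> \<le> a * ((norm x)\<^sup>2 + 1))"

definition subdifferential :: "('a::euclidean_space \<Rightarrow> real) \<Rightarrow> 'a \<Rightarrow> 'a set" where
  "subdifferential f x = {g. \<forall>y. f y \<ge> f x + g \<bullet> (y - x)}"

definition potential_energy :: "('a::euclidean_space \<Rightarrow> real) \<Rightarrow> 'a measure \<Rightarrow> real" where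
  "potential_energy f \<mu> = (\<integral>x. f x \<partial>\<mu>)"


subsection \<open>Functionals on the Wasserstein space\<close>

text \<open>A functional with values in the reals extended by \<open>+\<infinity>\<close> is an \<open>ereal\<close>-valued function
  that avoids \<open>-\<infinity>\<close> on \<open>P2\<close>; its values outside \<open>P2\<close> are irrelevant.\<close>

definition never_minus_infinity :: "('a::euclidean_space measure \<Rightarrow> ereal) \<Rightarrow> bool" where
  "never_minus_infinity \<phi> \<longleftrightarrow> (\<forall>\<mu>\<in>P2. \<phi> \<mu> \<noteq> -\<infinity>)"

definition domain_of :: "('a::euclidean_space measure \<Rightarrow> ereal) \<Rightarrow> 'a measure set" where
  "domain_of \<phi> = {\<mu> \<in> P2. \<phi> \<mu> < \<infinity>}"

definition proper_functional :: "('a::euclidean_space measure \<Rightarrow> ereal) \<Rightarrow> bool" where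
  "proper_functional \<phi> \<longleftrightarrow> domain_of \<phi> \<noteq> {}"

definition lsc_W2 :: "('a::euclidean_space measure \<Rightarrow> ereal) \<Rightarrow> bool" where
  "lsc_W2 \<phi> \<longleftrightarrow> (\<forall>\<mu>s \<mu>. (\<forall>n. \<mu>s n \<in> P2) \<longrightarrow> \<mu> \<in> P2 \<longrightarrow>
      (\<lambda>n. W2 (\<mu>s n) \<mu>) \<longlonglongrightarrow> 0 \<longrightarrow> \<phi> \<mu> \<le> liminf (\<lambda>n. \<phi> (\<mu>s n)))"

text \<open>In \<open>ereal\<close> we have \<open>0 * \<infinity> = 0\<close>, so the endpoint cases \<open>t = 0\<close> and \<open>t = 1\<close> are
  the trivial ones.\<close>

definition convex_along_gg :: "('a::euclidean_space measure \<Rightarrow> ereal) \<Rightarrow> bool" where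
  "convex_along_gg \<phi> \<longleftrightarrow> (\<forall>\<mu>\<in>P2. \<forall>\<pi>\<in>P2. \<forall>\<nu>\<in>P2abs. \<forall>t\<in>{0..1::real}.
      \<phi> (distr \<nu> borel (\<lambda>x. t *\<^sub>R optimal_map \<nu> \<mu> x + (1 - t) *\<^sub>R optimal_map \<nu> \<pi> x))
        \<le> ereal t * \<phi> \<mu> + ereal (1 - t) * \<phi> \<pi>)"

definition JKO ::
    "real \<Rightarrow> ('a::euclidean_space measure \<Rightarrow> ereal) \<Rightarrow> 'a measure \<Rightarrow> 'a measure set" where
  "JKO \<eta> \<phi> \<mu> =
    {\<nu>. is_arg_min (\<lambda>\<nu>. \<phi> \<nu> + ereal (1 / (2 * \<eta>) * (W2 \<mu> \<nu>)\<^sup>2)) (\<lambda>\<nu>. \<nu> \<in> P2) \<nu>}"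

text \<open>The second measure argument is the minimizer of the proximal step started from the
  forward step applied to \<open>\<mu>\<close>.\<close>

definition gradient_mapping ::
    "real \<Rightarrow> 'a::euclidean_space measure \<Rightarrow> 'a measure \<Rightarrow> 'a \<Rightarrow> 'a" where
  "gradient_mapping \<eta> \<mu> \<mu>' = (\<lambda>x. (1 / \<eta>) *\<^sub>R (x - optimal_map \<mu> \<mu>' x))"

end

theory Submission
  imports Defs
begin

text \<open>Pulling a coupling of \<open>\<nu>\<^sub>n\<^sub>+\<^sub>1 = (I + \<eta> S)\<^sub># \<mu>\<^sub>n\<close> and \<open>\<mu>\<^sub>n\<^sub>+\<^sub>1\<close> back along the nonexpansive
  inverse of \<open>I + \<eta> S\<close> and expanding the square, the subgradient inequality for \<open>H\<close> and the
  minimality of \<open>\<mu>\<^sub>n\<^sub>+\<^sub>1\<close> give \<open>W\<^sub>2(\<mu>\<^sub>n, \<mu>\<^sub>n\<^sub>+\<^sub>1)\<^sup>2 \<le> 2 \<eta> (F(\<mu>\<^sub>n) - F(\<mu>\<^sub>n\<^sub>+\<^sub>1))\<close>, which telescopes. The left-hand side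
  is \<open>\<eta>\<^sup>2\<close> times the squared norm of the gradient mapping because optimal maps exist (Brenier).

  For the latter, optimal plans are obtained by compactness, after moving measures to the
  real line along a space-filling curve. The support of an optimal plan is monotone, and a closed
  monotone set is multivalued over a Lebesgue null set only: in a coordinate
  direction, the multivalued points on a line are jumps of a monotone
  function, so there are countably many of them on each line.\<close>

section \<open>A space-filling curve and compactness\<close>

text \<open>The descent inequality is proved for every coupling of the forward measure with the next
  iterate and then passes to the infimum, so no optimal map out of the forward measure has to be
  chosen. Optimal maps enter at one point only: the gradient mapping is built from a choice
  operator, and an existence proof is what makes its norm a Wasserstein distance. In the existence
  of optimal plans the obstacle is mass escaping to infinity. Space is squashed into a box, and the
  fixed marginals prevent the limit from charging the boundary sphere that stands for infinity.
  Since the limit is taken with convergent random variables, Fatou's lemma yields lower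
  semicontinuity of the cost. The map is then read off the closed support of the plan, without
  Kantorovich potentials. Telescoping starts at n = 1: \<open>\<H> (\<mu> 0)\<close> may be
  infinite, while every backward step lands in the domain of \<open>\<H>\<close>, hence in
  \<open>P2abs\<close>.\<close>

definition schoenberg_step :: "real \<Rightarrow> real" where
  "schoenberg_step t = max 0 (min 1 (1 / 2 - cos (pi * t)))"

text \<open>The digit of weight \<open>(1 / 2) ^ Suc k\<close>. Written with floors it is visibly
  Borel in \<open>u\<close>, and the partial sums of the expansion telescope.\<close>

definition binary_digit :: "real \<Rightarrow> nat \<Rightarrow> real" where
  "binary_digit u k = of_int \<lfloor>2 ^ Suc k * u\<rfloor> - 2 * of_int \<lfloor>2 ^ k * u\<rfloor>"

lemma binary_digit_cases: "binary_digit u k = 0 \<or> binary_digit u k = 1"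
proof -
  have "\<lfloor>2 ^ Suc k * u\<rfloor> - 2 * \<lfloor>2 ^ k * u\<rfloor> \<in> {0, 1}"
  proof -
    have "\<lfloor>2 * v\<rfloor> - 2 * \<lfloor>v\<rfloor> = 0 \<or> \<lfloor>2 * v\<rfloor> - 2 * \<lfloor>v\<rfloor> = 1" for v :: real by linarith
    from this[of "2 ^ k * u"] show ?thesis by (simp add: mult.assoc)
  qed
  then have "of_int (\<lfloor>2 ^ Suc k * u\<rfloor> - 2 * \<lfloor>2 ^ k * u\<rfloor>) \<in> {0, 1 :: real}" by auto
  then show ?thesis unfolding binary_digit_def by auto
qed

lemma binary_digit_sums:
  assumes "0 \<le> u" "u < 1"
  shows "(\<lambda>k. binary_digit u k * (1 / 2) ^ Suc k) sums u"
proof -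
  have partial: "(\<Sum>k<n. binary_digit u k * (1 / 2) ^ Suc k) = of_int \<lfloor>2 ^ n * u\<rfloor> / 2 ^ n" for n
  proof (induction n)
    case 0
    have "\<lfloor>u\<rfloor> = 0" using assms by linarith
    then show ?case by simp
  next
    case (Suc n)
    then show ?case
      by (simp add: binary_digit_def field_simps)
  qed
  have "(\<lambda>n. of_int \<lfloor>2 ^ n * u\<rfloor> / 2 ^ n) \<longlonglongrightarrow> u"
  proof (rule tendsto_sandwich)
    have "u - (1 / 2) ^ n \<le> of_int \<lfloor>2 ^ n * u\<rfloor> / 2 ^ n" for n :: nat
    proof -
      have "2 ^ n * u - 1 \<le> of_int \<lfloor>2 ^ n * u\<rfloor>" by linarith
      then have "(2 ^ n * u - 1) / 2 ^ n \<le> of_int \<lfloor>2 ^ n * u\<rfloor> / 2 ^ n"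
        by (intro divide_right_mono) auto
      then show ?thesis by (simp add: field_simps)
    qed
    then show "\<forall>\<^sub>F n in sequentially. u - (1 / 2) ^ n \<le> of_int \<lfloor>2 ^ n * u\<rfloor> / 2 ^ n" by auto
    have "of_int \<lfloor>2 ^ n * u\<rfloor> / 2 ^ n \<le> u" for n :: nat
      by (simp add: divide_le_eq mult.commute)
    then show "\<forall>\<^sub>F n in sequentially. of_int \<lfloor>2 ^ n * u\<rfloor> / 2 ^ n \<le> u" by auto
    have "(\<lambda>n. u - (1 / 2) ^ n) \<longlonglongrightarrow> u - 0"
      by (intro tendsto_intros LIMSEQ_power_zero) auto
    then show "(\<lambda>n. u - (1 / 2) ^ n) \<longlonglongrightarrow> u" by simp
  qed auto
  then show ?thesis unfolding sums_def partial .
qed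

lemma schoenberg_step_bounds: "0 \<le> schoenberg_step t" "schoenberg_step t \<le> 1"
  by (auto simp: schoenberg_step_def)

lemma continuous_on_schoenberg_step [continuous_intros]:
  fixes f :: "real \<Rightarrow> real"
  shows "continuous_on A f \<Longrightarrow> continuous_on A (\<lambda>x. schoenberg_step (f x))"
  unfolding schoenberg_step_def by (intro continuous_intros continuous_on_cos)

lemma schoenberg_step_even_shift: "schoenberg_step (2 * of_int m + s) = schoenberg_step s"
proof -
  have "cos (pi * (2 * of_int m + s)) = cos (pi * s + of_int m * (2 * pi))"
    by (simp add: algebra_simps)
  also have "\<dots> = cos (pi * s)"
    using cos_int_2pin[of m] sin_int_2pin[of m] by (simp add: cos_add mult.commute[of "2 * pi"])
  finally show ?thesis by (simp add: schoenberg_step_def)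
qed

text \<open>The clipped cosine is even and 2-periodic, with plateaus 0 on [0, 1/3] and 1 on
  [2/3, 1]. These are the intervals of numbers whose leading ternary digit is 0 or 2.\<close>

lemma schoenberg_step_eq_0:
  assumes "0 \<le> s" "s \<le> 1 / 3"
  shows "schoenberg_step s = 0"
proof -
  have "cos (pi / 3) \<le> cos (pi * s)"
    using assms by (intro cos_monotone_0_pi_le) (auto simp: field_simps)
  then show ?thesis by (simp add: schoenberg_step_def cos_60)
qed

lemma schoenberg_step_eq_1:
  assumes "2 / 3 \<le> s" "s \<le> 1"
  shows "schoenberg_step s = 1"
proof -
  have "cos (pi * s) \<le> cos (2 * pi / 3)"
    using assms by (intro cos_monotone_0_pi_le) (auto simp: field_simps)
  then show ?thesis by (simp add: schoenberg_step_def cos_120)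
qed

text \<open>For binary digits \<open>a\<close> this is a point of the Cantor set: the ternary digits
  are 0 and 2 only. The gap between them is what lets a continuous function read the digits.\<close>

definition ternary_sum :: "(nat \<Rightarrow> real) \<Rightarrow> real" where
  "ternary_sum a = (\<Sum>j. 2 * a j * (1 / 3) ^ Suc j)"

lemma summable_ternary:
  assumes "\<And>j. a j \<in> {0, 1 :: real}"
  shows "summable (\<lambda>j. 2 * a j * (1 / 3) ^ Suc j)"
proof (rule summable_comparison_test')
  show "summable (\<lambda>j. 2 * (1 / 3) ^ Suc j :: real)"
    by (intro summable_mult summable_Suc_iff[THEN iffD2] summable_geometric) auto
  show "norm (2 * a j * (1 / 3) ^ Suc j) \<le> 2 * (1 / 3) ^ Suc j" if "0 \<le> j" for j
    using assms[of j] by auto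
qed

lemma ternary_sum_bounds:
  assumes "\<And>j. a j \<in> {0, 1 :: real}"
  shows "0 \<le> ternary_sum a" "ternary_sum a \<le> 1"
proof -
  show "0 \<le> ternary_sum a" unfolding ternary_sum_def
  proof (rule suminf_nonneg[OF summable_ternary[of a]])
    show "0 \<le> 2 * a j * (1 / 3) ^ Suc j" for j using assms[of j] by auto
  qed (use assms in auto)
  have s: "(\<lambda>j. 2 * (1 / 3) ^ Suc j :: real) sums 1"
    using sums_mult[OF geometric_sums[of "1 / 3 :: real"], of "2 / 3"] by simp
  have "ternary_sum a \<le> (\<Sum>j. 2 * (1 / 3) ^ Suc j)" unfolding ternary_sum_def
  proof (rule suminf_le)
    show "2 * a j * (1 / 3) ^ Suc j \<le> 2 * (1 / 3) ^ Suc j" for j using assms[of j] by auto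
  qed (use s summable_ternary[of a] assms in \<open>auto simp: sums_iff\<close>)
  then show "ternary_sum a \<le> 1" using s by (simp add: sums_iff)
qed

lemma ternary_sum_Suc:
  assumes "\<And>j. a j \<in> {0, 1 :: real}"
  shows "3 * ternary_sum a = 2 * a 0 + ternary_sum (\<lambda>j. a (Suc j))"
proof -
  have "ternary_sum a = (\<Sum>j. 2 * a (Suc j) * (1 / 3) ^ Suc (Suc j)) + 2 * a 0 * (1 / 3) ^ Suc 0"
    unfolding ternary_sum_def by (subst suminf_split_head[OF summable_ternary[of a]]) (use assms in auto)
  also have "(\<Sum>j. 2 * a (Suc j) * (1 / 3) ^ Suc (Suc j)) = (\<Sum>j. (1 / 3) * (2 * a (Suc j) * (1 / 3) ^ Suc j))"
    by (simp add: mult_ac)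
  also have "\<dots> = (1 / 3) * ternary_sum (\<lambda>j. a (Suc j))"
    unfolding ternary_sum_def
    by (rule suminf_mult) (rule summable_ternary, use assms in auto)
  finally show ?thesis by simp
qed

text \<open>Multiplication by 3 moves the leading ternary digit, 0 or 2, in front of the point,
  where it is multiplied by powers of 3 and stays an even integer invisible to the periodic step.
  After \<open>n\<close> multiplications digit \<open>n\<close> leads, and the plateaus read it
  whatever the tail in [0, 1] is.\<close>

lemma schoenberg_step_ternary:
  assumes "\<And>j. a j \<in> {0, 1 :: real}"
  shows "schoenberg_step (3 ^ n * ternary_sum a) = a n"
  using assms
proof (induction n arbitrary: a)
  case 0
  let ?r = "ternary_sum (\<lambda>j. a (Suc j))"
  have r: "0 \<le> ?r" "?r \<le> 1" using ternary_sum_bounds[of "\<lambda>j. a (Suc j)"] 0 by auto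
  have t: "ternary_sum a = 2 / 3 * a 0 + ?r / 3" using ternary_sum_Suc[of a] 0 by simp
  show ?case
  proof (cases "a 0 = 0")
    case True
    then show ?thesis using t r by (simp add: schoenberg_step_eq_0)
  next
    case False
    then have "a 0 = 1" using 0[of 0] by auto
    then show ?thesis using t r by (simp add: schoenberg_step_eq_1)
  qed
next
  case (Suc n)
  have a0: "a 0 = of_bool (a 0 = 1)" using Suc.prems[of 0] by auto
  have "3 ^ Suc n * ternary_sum a = 3 ^ n * (3 * ternary_sum a)" by simp
  also have "\<dots> = 2 * of_int (3 ^ n * of_bool (a 0 = 1)) + 3 ^ n * ternary_sum (\<lambda>j. a (Suc j))"
    using ternary_sum_Suc[of a] Suc.prems a0 by (simp add: algebra_simps)
  finally have "schoenberg_step (3 ^ Suc n * ternary_sum a)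
      = schoenberg_step (3 ^ n * ternary_sum (\<lambda>j. a (Suc j)))"
    by (simp only: schoenberg_step_even_shift)
  then show ?case using Suc.IH[of "\<lambda>j. a (Suc j)"] Suc.prems by simp
qed

text \<open>Schoenberg's Peano curve. Digit \<open>k\<close> of coordinate number \<open>i\<close>
  is read at the ternary place \<open>prod_encode (i, k)\<close>, so the pairing function serves
  every finite dimension at once.\<close>

definition schoenberg_curve :: "real \<Rightarrow> 'b::euclidean_space" where
  "schoenberg_curve t = (\<Sum>b\<in>Basis. (\<Sum>k. schoenberg_step
      (3 ^ prod_encode (to_nat_on (Basis :: 'b set) b, k) * t) * (1 / 2) ^ Suc k) *\<^sub>R b)"

text \<open>A Borel right inverse of the curve on the half-open unit box. It need not be continuous:
  it only carries measures to the line, and the way back is the continuous curve. Places whose index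
  \<open>i\<close> exceeds the dimension hold digits that the curve never reads.\<close>

definition schoenberg_section :: "'b::euclidean_space \<Rightarrow> real" where
  "schoenberg_section y = ternary_sum (\<lambda>p. case prod_decode p of
      (i, k) \<Rightarrow> binary_digit (y \<bullet> from_nat_into Basis i) k)"

lemma continuous_schoenberg_curve: "continuous_on UNIV (schoenberg_curve :: real \<Rightarrow> 'b::euclidean_space)"
proof -
  have "continuous_on UNIV (\<lambda>t. \<Sum>k. schoenberg_step (3 ^ prod_encode (i, k) * t) * (1 / 2) ^ Suc k)" for i
  proof (rule uniform_limit_theorem)
    show "\<forall>\<^sub>F n in sequentially. continuous_on UNIV
        (\<lambda>t. \<Sum>k<n. schoenberg_step (3 ^ prod_encode (i, k) * t) * (1 / 2) ^ Suc k)"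
      by (intro always_eventually allI continuous_intros)
    show "uniform_limit UNIV
        (\<lambda>n t. \<Sum>k<n. schoenberg_step (3 ^ prod_encode (i, k) * t) * (1 / 2) ^ Suc k)
        (\<lambda>t. \<Sum>k. schoenberg_step (3 ^ prod_encode (i, k) * t) * (1 / 2) ^ Suc k) sequentially"
    proof (rule Weierstrass_m_test)
      show "norm (schoenberg_step (3 ^ prod_encode (i, k) * t) * (1 / 2) ^ Suc k) \<le> (1 / 2) ^ Suc k" for k t
        using schoenberg_step_bounds[of "3 ^ prod_encode (i, k) * t"] by auto
      show "summable (\<lambda>k. (1 / 2) ^ Suc k :: real)"
        by (intro summable_Suc_iff[THEN iffD2] summable_geometric) auto
    qed
  qed auto
  then show ?thesis unfolding schoenberg_curve_def[abs_def] by (intro continuous_intros)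
qed

lemma measurable_schoenberg_section [measurable]:
  "schoenberg_section \<in> borel_measurable (borel :: 'b::euclidean_space measure)"
  unfolding schoenberg_section_def[abs_def] ternary_sum_def binary_digit_def case_prod_beta
  by measurable

lemma digit_mem: "(case q of (i, k) \<Rightarrow> binary_digit (f i) k) \<in> {0, 1}"
  using binary_digit_cases by (auto split: prod.split)

lemma schoenberg_section_bounds: "0 \<le> schoenberg_section y" "schoenberg_section y \<le> 1"
  unfolding schoenberg_section_def by (intro ternary_sum_bounds digit_mem)+

lemma schoenberg_curve_section:
  fixes y :: "'b::euclidean_space"
  assumes "\<And>b. b \<in> Basis \<Longrightarrow> 0 \<le> y \<bullet> b \<and> y \<bullet> b < 1"
  shows "schoenberg_curve (schoenberg_section y) = y"
proof -
  have "(\<Sum>k. schoenberg_step (3 ^ prod_encode (to_nat_on (Basis :: 'b set) b, k) * schoenberg_section y)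
      * (1 / 2) ^ Suc k) = y \<bullet> b" if b: "b \<in> Basis" for b
  proof -
    have "from_nat_into (Basis :: 'b set) (to_nat_on (Basis :: 'b set) b) = b"
      using b by (intro from_nat_into_to_nat_on countable_finite) auto
    then have "schoenberg_step (3 ^ prod_encode (to_nat_on (Basis :: 'b set) b, k) * schoenberg_section y)
        = binary_digit (y \<bullet> b) k" for k
      unfolding schoenberg_section_def by (subst schoenberg_step_ternary[OF digit_mem]) simp
    then show ?thesis
      using binary_digit_sums[of "y \<bullet> b"] assms[OF b] by (simp add: sums_iff)
  qed
  then show ?thesis
    unfolding schoenberg_curve_def by (simp add: euclidean_representation)
qed

text \<open>Fatou's lemma applied to indicators of open sets bounds the limit law by
  \<open>N\<close> on open sets, outer regularity extends this to Borel sets, and passing to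
  complements turns the inequality between probability measures into equality. It serves to keep the
  marginals of couplings in the limit.\<close>

lemma distr_eq_of_AE_limit:
  fixes X :: "nat \<Rightarrow> 'w \<Rightarrow> 'b::euclidean_space"
  assumes \<Omega>: "prob_space \<Omega>"
    and X [measurable]: "\<And>n. X n \<in> borel_measurable \<Omega>" and X0 [measurable]: "X0 \<in> borel_measurable \<Omega>"
    and lim: "AE \<omega> in \<Omega>. (\<lambda>n. X n \<omega>) \<longlonglongrightarrow> X0 \<omega>"
    and law: "\<And>n. distr \<Omega> borel (X n) = N"
  shows "distr \<Omega> borel X0 = N"
proof -
  interpret \<Omega>: prob_space \<Omega> by fact
  have sN [simp]: "sets N = sets borel" and spN [simp]: "space N = UNIV" using law[of 0] by auto
  interpret N: prob_space N using \<Omega>.prob_space_distr[OF X[of 0]] law[of 0] by simp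
  define L where "L = distr \<Omega> borel X0"
  have sL [simp]: "sets L = sets borel" and spL [simp]: "space L = UNIV" by (auto simp: L_def)
  interpret L: prob_space L unfolding L_def by (intro \<Omega>.prob_space_distr X0)
  have open_le: "emeasure L U \<le> emeasure N U" if U: "open U" for U
  proof -
    have [measurable]: "U \<in> sets borel" using U by auto
    have "emeasure L U = (\<integral>\<^sup>+\<omega>. indicator U (X0 \<omega>) \<partial>\<Omega>)"
      unfolding L_def
      by (subst nn_integral_distr[symmetric, of X0 \<Omega> borel "indicator U"]) auto
    also have "\<dots> \<le> (\<integral>\<^sup>+\<omega>. liminf (\<lambda>n. indicator U (X n \<omega>)) \<partial>\<Omega>)"
    proof (rule nn_integral_mono_AE)
      show "AE \<omega> in \<Omega>. indicator U (X0 \<omega>) \<le> liminf (\<lambda>n. indicator U (X n \<omega>) :: ennreal)"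
        using lim
      proof eventually_elim
        case (elim \<omega>)
        show ?case
        proof (cases "X0 \<omega> \<in> U")
          case True
          then have "\<forall>\<^sub>F n in sequentially. X n \<omega> \<in> U" using elim U by (auto simp: tendsto_def)
          then have "\<forall>\<^sub>F n in sequentially. 1 \<le> (indicator U (X n \<omega>) :: ennreal)"
            by eventually_elim auto
          then show ?thesis using True by (simp add: Liminf_bounded)
        qed auto
      qed
    qed
    also have "\<dots> \<le> liminf (\<lambda>n. \<integral>\<^sup>+\<omega>. indicator U (X n \<omega>) \<partial>\<Omega>)"
      by (rule nn_integral_liminf) measurable
    also have "(\<lambda>n. \<integral>\<^sup>+\<omega>. indicator U (X n \<omega>) \<partial>\<Omega>) = (\<lambda>n. emeasure N U)"
    proof
      fix n
      show "(\<integral>\<^sup>+\<omega>. indicator U (X n \<omega>) \<partial>\<Omega>) = emeasure N U"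
        unfolding law[of n, symmetric]
        by (subst nn_integral_distr[symmetric, of "X n" \<Omega> borel "indicator U"]) auto
    qed
    finally show ?thesis by (simp add: Liminf_const)
  qed
  have le: "emeasure L B \<le> emeasure N B" if "B \<in> sets borel" for B
  proof -
    have "emeasure L B = (INF U\<in>{U. B \<subseteq> U \<and> open U}. emeasure L U)"
      using that L.emeasure_space_1 by (intro outer_regular) auto
    also have "\<dots> \<le> (INF U\<in>{U. B \<subseteq> U \<and> open U}. emeasure N U)"
      by (rule INF_mono) (auto intro: open_le)
    also have "\<dots> = emeasure N B"
      using that N.emeasure_space_1 by (intro outer_regular[symmetric]) auto
    finally show ?thesis .
  qed
  have "L = N"
  proof (rule measure_eqI)
    fix B assume "B \<in> sets L"
    then have B: "B \<in> sets borel" by simp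
    then have B': "- B \<in> sets borel" using sets.compl_sets[of B borel] by (simp add: Compl_eq_Diff_UNIV)
    have "measure L B \<le> measure N B" "measure L (- B) \<le> measure N (- B)"
      using le[OF B] le[OF B'] by (auto simp: L.emeasure_eq_measure N.emeasure_eq_measure)
    moreover have "measure L (- B) = 1 - measure L B" "measure N (- B) = 1 - measure N B"
      using L.prob_compl[of B] N.prob_compl[of B] B by (auto simp: Compl_eq_Diff_UNIV)
    ultimately show "emeasure L B = emeasure N B"
      by (simp add: L.emeasure_eq_measure N.emeasure_eq_measure)
  qed simp
  then show ?thesis by (simp add: L_def)
qed

text \<open>The curve turns a sequence of measures on the box into one on the line, where Helly's
  selection theorem and Skorohod's representation are available.\<close>

lemma skorohod_unit_box:
  fixes M :: "nat \<Rightarrow> 'b::euclidean_space measure"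
  assumes M: "\<And>n. prob_space (M n)" and sets_M: "\<And>n. sets (M n) = sets borel"
    and box: "\<And>n. AE x in M n. \<forall>b\<in>Basis. 0 \<le> x \<bullet> b \<and> x \<bullet> b < 1"
  shows "\<exists>(r :: nat \<Rightarrow> nat) (\<Omega> :: real measure) Z Z0. strict_mono r \<and> prob_space \<Omega> \<and>
    (\<forall>n. Z n \<in> borel_measurable \<Omega>) \<and> Z0 \<in> borel_measurable \<Omega> \<and>
    (\<forall>n. distr \<Omega> borel (Z n) = M (r n)) \<and>
    (\<forall>\<omega>\<in>space \<Omega>. (\<lambda>n. Z n \<omega>) \<longlonglongrightarrow> (Z0 \<omega> :: 'b))"
proof -
  define m where "m n = distr (M n) borel schoenberg_section" for n
  have sec: "schoenberg_section \<in> borel_measurable (M n)" for n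
    using measurable_schoenberg_section by (simp cong: measurable_cong_sets add: sets_M)
  have rd: "real_distribution (m n)" for n
    unfolding m_def real_distribution_def real_distribution_axioms_def
    using prob_space.prob_space_distr[OF M sec] by simp
  have gt: "-1 < schoenberg_section x" for x :: 'b
    using schoenberg_section_bounds(1)[of x] by linarith
  \<comment> \<open>Tightness is tested on left-open intervals, and the section may take the value
    0; hence the left end -1.\<close>
  have "measure (m n) {-1<..1} = 1" for n
  proof -
    have "schoenberg_section -` {-1<..1} \<inter> space (M n) = space (M n)"
      using schoenberg_section_bounds(2) gt by auto
    then show ?thesis unfolding m_def using sec prob_space.prob_space[OF M]
      by (simp add: measure_distr)
  qed
  then have "\<exists>a b. a < b \<and> (\<forall>n. measure (m n) {a<..b} > 1 - \<epsilon>)" if "\<epsilon> > 0" for \<epsilon>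
    using that by (intro exI[of _ "-1"] exI[of _ 1]) simp
  then have "tight m" unfolding tight_def using rd by blast
  from tight_imp_convergent_subsubsequence[OF this, of id]
  obtain r L where r: "strict_mono r" and L: "real_distribution L" and "weak_conv_m (m \<circ> r) L"
    by (auto simp: strict_mono_def)
  moreover have "real_distribution ((m \<circ> r) n)" for n using rd by simp
  ultimately have "\<exists>(\<Omega> :: real measure) Y Y0. prob_space \<Omega> \<and> (\<forall>n. Y n \<in> measurable \<Omega> borel) \<and>
      (\<forall>n. distr \<Omega> borel (Y n) = (m \<circ> r) n) \<and> Y0 \<in> measurable \<Omega> lborel \<and>
      distr \<Omega> borel Y0 = L \<and> (\<forall>\<omega>\<in>space \<Omega>. (\<lambda>n. Y n \<omega>) \<longlonglongrightarrow> Y0 \<omega>)"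
    by (intro Skorohod)
  then obtain \<Omega> :: "real measure" and Y Y0 where \<Omega>: "prob_space \<Omega>"
    and Y: "\<And>n. Y n \<in> borel_measurable \<Omega>" "\<And>n. distr \<Omega> borel (Y n) = m (r n)"
    and Y0: "Y0 \<in> borel_measurable \<Omega>"
    and lim: "\<And>\<omega>. \<omega> \<in> space \<Omega> \<Longrightarrow> (\<lambda>n. Y n \<omega>) \<longlonglongrightarrow> Y0 \<omega>"
    unfolding measurable_lborel1 o_apply by blast
  \<comment> \<open>Composing with the curve restores the original laws, because it undoes the
    section almost surely, and keeps pointwise convergence, because it is continuous on the whole
    line.\<close>
  define c :: "real \<Rightarrow> 'b" where "c = schoenberg_curve"
  have c: "continuous_on UNIV c" unfolding c_def by (rule continuous_schoenberg_curve)
  then have [measurable]: "c \<in> borel_measurable borel" by (rule borel_measurable_continuous_onI)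
  note Y [measurable] Y0 [measurable]
  show ?thesis
  proof (intro exI[of _ r] exI[of _ \<Omega>] exI[of _ "\<lambda>n \<omega>. c (Y n \<omega>)"] exI[of _ "\<lambda>\<omega>. c (Y0 \<omega>)"]
      conjI allI ballI r \<Omega>)
    fix n
    have "distr \<Omega> borel (\<lambda>\<omega>. c (Y n \<omega>)) = distr (distr \<Omega> borel (Y n)) borel c"
      by (subst distr_distr) (auto simp: o_def)
    also have "\<dots> = distr (M (r n)) borel (\<lambda>x. c (schoenberg_section x))"
      unfolding Y(2) m_def using sec by (subst distr_distr) (auto simp: o_def)
    also have "\<dots> = distr (M (r n)) borel (\<lambda>x. x)"
    proof (rule distr_cong_AE)
      show "AE x in M (r n). c (schoenberg_section x) = x"
        using box[of "r n"] by eventually_elim (auto simp: c_def intro!: schoenberg_curve_section)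
      show "(\<lambda>x. c (schoenberg_section x)) \<in> borel_measurable (M (r n))"
        using sec by measurable
    qed (auto simp: sets_M cong: measurable_cong_sets)
    also have "\<dots> = M (r n)" by (intro distr_id2 sets_M[symmetric])
    finally show "distr \<Omega> borel (\<lambda>\<omega>. c (Y n \<omega>)) = M (r n)" .
  next
    fix \<omega> assume "\<omega> \<in> space \<Omega>"
    have "isCont c (Y0 \<omega>)" using c by (simp add: continuous_on_eq_continuous_at)
    from isCont_tendsto_compose[OF this lim[OF \<open>\<omega> \<in> space \<Omega>\<close>]]
    show "(\<lambda>n. c (Y n \<omega>)) \<longlonglongrightarrow> c (Y0 \<omega>)" .
  qed measurable
qed

section \<open>Couplings and optimal plans\<close>

lemma couplingsD:
  assumes "\<gamma> \<in> couplings \<mu> \<nu>"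
  shows "prob_space \<gamma>" "sets \<gamma> = sets (borel :: ('a::euclidean_space \<times> 'a) measure)"
    "distr \<gamma> borel fst = \<mu>" "distr \<gamma> borel snd = (\<nu> :: 'a measure)"
  using assms unfolding couplings_def borel_prod mem_Collect_eq by blast+

lemma couplingsI:
  fixes \<gamma> :: "('a::euclidean_space \<times> 'a) measure"
  assumes "prob_space \<gamma>" "sets \<gamma> = sets borel" "distr \<gamma> borel fst = \<mu>" "distr \<gamma> borel snd = \<nu>"
  shows "\<gamma> \<in> couplings \<mu> \<nu>"
  using assms unfolding couplings_def borel_prod mem_Collect_eq by blast

lemma distr_in_couplings:
  fixes f g :: "'w \<Rightarrow> 'a::euclidean_space"
  assumes "prob_space \<Omega>" and [measurable]: "f \<in> borel_measurable \<Omega>" "g \<in> borel_measurable \<Omega>"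
  shows "distr \<Omega> (borel \<Otimes>\<^sub>M borel) (\<lambda>\<omega>. (f \<omega>, g \<omega>)) \<in> couplings (distr \<Omega> borel f) (distr \<Omega> borel g)"
proof (rule couplingsI)
  show "prob_space (distr \<Omega> (borel \<Otimes>\<^sub>M borel) (\<lambda>\<omega>. (f \<omega>, g \<omega>)))"
    by (intro prob_space.prob_space_distr assms) measurable
  show "sets (distr \<Omega> (borel \<Otimes>\<^sub>M borel) (\<lambda>\<omega>. (f \<omega>, g \<omega>))) = sets borel"
    by (simp only: sets_distr borel_prod)
qed (auto simp: distr_distr o_def)

lemma P2D:
  assumes "\<mu> \<in> P2"
  shows "prob_space \<mu>" "sets \<mu> = sets borel" "space \<mu> = UNIV" "integrable \<mu> (\<lambda>x. (norm x)\<^sup>2)"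
  using assms sets_eq_imp_space_eq[of \<mu> borel] by (auto simp: P2_def)

lemma norm_diff_square_le: "(norm (x - y))\<^sup>2 \<le> 2 * (norm x)\<^sup>2 + 2 * (norm (y :: 'a::real_inner))\<^sup>2"
proof -
  have "0 \<le> (norm (x + y))\<^sup>2" by simp
  then show ?thesis by (simp add: power2_norm_eq_inner algebra_simps inner_commute)
qed

lemma integrable_marginals:
  fixes \<gamma> :: "('a::euclidean_space \<times> 'a) measure" and f :: "'a \<Rightarrow> real"
  assumes \<gamma>: "\<gamma> \<in> couplings \<mu> \<nu>" and [measurable]: "f \<in> borel_measurable borel"
  shows "integrable \<mu> f \<Longrightarrow> integrable \<gamma> (\<lambda>z. f (fst z))"
    and "integrable \<nu> f \<Longrightarrow> integrable \<gamma> (\<lambda>z. f (snd z))"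
    and "(\<integral>z. f (fst z) \<partial>\<gamma>) = (\<integral>x. f x \<partial>\<mu>)"
    and "(\<integral>z. f (snd z) \<partial>\<gamma>) = (\<integral>x. f x \<partial>\<nu>)"
proof -
  have [measurable]: "fst \<in> borel_measurable \<gamma>" "snd \<in> borel_measurable \<gamma>"
    using couplingsD(2)[OF \<gamma>] by (auto cong: measurable_cong_sets simp: borel_prod[symmetric])
  show "integrable \<mu> f \<Longrightarrow> integrable \<gamma> (\<lambda>z. f (fst z))"
    by (subst (asm) couplingsD(3)[OF \<gamma>, symmetric]) (rule integrable_distr, simp_all)
  show "integrable \<nu> f \<Longrightarrow> integrable \<gamma> (\<lambda>z. f (snd z))"
    by (subst (asm) couplingsD(4)[OF \<gamma>, symmetric]) (rule integrable_distr, simp_all)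
  show "(\<integral>z. f (fst z) \<partial>\<gamma>) = (\<integral>x. f x \<partial>\<mu>)"
    by (subst couplingsD(3)[OF \<gamma>, symmetric]) (simp add: integral_distr)
  show "(\<integral>z. f (snd z) \<partial>\<gamma>) = (\<integral>x. f x \<partial>\<nu>)"
    by (subst couplingsD(4)[OF \<gamma>, symmetric]) (simp add: integral_distr)
qed

lemma integrable_cost:
  assumes \<gamma>: "\<gamma> \<in> couplings \<mu> \<nu>" and \<mu>: "\<mu> \<in> P2" and \<nu>: "\<nu> \<in> P2"
  shows "integrable \<gamma> (\<lambda>z. (norm (fst z - snd z))\<^sup>2)"
proof (rule Bochner_Integration.integrable_bound)
  show "integrable \<gamma> (\<lambda>z. 2 * (norm (fst z))\<^sup>2 + 2 * (norm (snd z))\<^sup>2)"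
    using integrable_marginals(1)[OF \<gamma> _ P2D(4)[OF \<mu>]] integrable_marginals(2)[OF \<gamma> _ P2D(4)[OF \<nu>]]
    by auto
  show "(\<lambda>z. (norm (fst z - snd z))\<^sup>2) \<in> borel_measurable \<gamma>"
    using couplingsD(2)[OF \<gamma>] by (simp add: borel_prod[symmetric] cong: measurable_cong_sets)
  show "AE z in \<gamma>. norm ((norm (fst z - snd z))\<^sup>2) \<le> norm (2 * (norm (fst z))\<^sup>2 + 2 * (norm (snd z))\<^sup>2)"
    using norm_diff_square_le by (auto intro!: always_eventually)
qed

lemma couplings_nonempty:
  assumes \<mu>: "\<mu> \<in> P2" and \<nu>: "\<nu> \<in> P2"
  shows "couplings \<mu> \<nu> \<noteq> {}"
proof -
  interpret M: prob_space \<mu> by (rule P2D[OF \<mu>])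
  interpret N: prob_space \<nu> by (rule P2D[OF \<nu>])
  interpret pair_prob_space \<mu> \<nu> ..
  have "\<mu> \<Otimes>\<^sub>M \<nu> \<in> couplings \<mu> \<nu>"
  proof (rule couplingsI)
    show "prob_space (\<mu> \<Otimes>\<^sub>M \<nu>)" by (rule prob_space_axioms)
    show "sets (\<mu> \<Otimes>\<^sub>M \<nu>) = sets borel"
      using P2D(2)[OF \<mu>] P2D(2)[OF \<nu>] by (simp add: borel_prod[symmetric] cong: sets_pair_measure_cong)
    have "distr (\<mu> \<Otimes>\<^sub>M \<nu>) borel fst = distr (\<mu> \<Otimes>\<^sub>M \<nu>) \<mu> fst"
      using P2D(2)[OF \<mu>] by (intro distr_cong) auto
    also have "\<dots> = \<mu>" using N.distr_pair_fst[of \<mu>] N.emeasure_space_1 by simp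
    finally show "distr (\<mu> \<Otimes>\<^sub>M \<nu>) borel fst = \<mu>" .
    have "distr (\<mu> \<Otimes>\<^sub>M \<nu>) borel snd = distr (\<mu> \<Otimes>\<^sub>M \<nu>) \<nu> snd"
      using P2D(2)[OF \<nu>] by (intro distr_cong) auto
    also have "\<dots> = distr (\<nu> \<Otimes>\<^sub>M \<mu>) \<nu> fst"
      by (subst distr_pair_swap) (auto simp: distr_distr o_def case_prod_beta intro!: distr_cong)
    also have "\<dots> = \<nu>" using M.distr_pair_fst[of \<nu>] M.emeasure_space_1 by simp
    finally show "distr (\<mu> \<Otimes>\<^sub>M \<nu>) borel snd = \<nu>" .
  qed
  then show ?thesis by auto
qed

lemma transport_cost_nonneg: "0 \<le> transport_cost \<gamma>"
  by (auto simp: transport_cost_def)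

lemma bdd_below_transport_cost: "bdd_below (transport_cost ` C)"
  by (rule bdd_belowI[of _ 0]) (auto simp: transport_cost_nonneg)

lemma INF_transport_cost_nonneg: "0 \<le> (INF \<gamma>\<in>couplings \<mu> \<nu>. transport_cost \<gamma>)"
  if "couplings \<mu> \<nu> \<noteq> {}"
  using that by (intro cINF_greatest) (auto simp: transport_cost_nonneg)

lemma W2_square_le:
  assumes "\<gamma> \<in> couplings \<mu> \<nu>"
  shows "(W2 \<mu> \<nu>)\<^sup>2 \<le> transport_cost \<gamma>"
proof -
  have "0 \<le> (INF \<gamma>\<in>couplings \<mu> \<nu>. transport_cost \<gamma>)"
    using assms by (intro INF_transport_cost_nonneg) auto
  then show ?thesis
    unfolding W2_def using assms by (simp add: cINF_lower bdd_below_transport_cost)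
qed

lemma W2_square_ge:
  assumes "couplings \<mu> \<nu> \<noteq> {}" "\<And>\<gamma>. \<gamma> \<in> couplings \<mu> \<nu> \<Longrightarrow> c \<le> transport_cost \<gamma>"
  shows "c \<le> (W2 \<mu> \<nu>)\<^sup>2"
  unfolding W2_def using INF_transport_cost_nonneg[OF assms(1)] cINF_greatest[OF assms(1), of c transport_cost] assms(2)
  by simp

lemma optimal_plans_cost:
  assumes "\<gamma> \<in> optimal_plans \<mu> \<nu>"
  shows "transport_cost \<gamma> = (W2 \<mu> \<nu>)\<^sup>2"
proof (rule antisym)
  have \<gamma>: "\<gamma> \<in> couplings \<mu> \<nu>" "\<And>\<gamma>'. \<gamma>' \<in> couplings \<mu> \<nu> \<Longrightarrow> transport_cost \<gamma> \<le> transport_cost \<gamma>'"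
    using assms by (auto simp: optimal_plans_def is_arg_min_linorder)
  then show "transport_cost \<gamma> \<le> (W2 \<mu> \<nu>)\<^sup>2" by (intro W2_square_ge) auto
  show "(W2 \<mu> \<nu>)\<^sup>2 \<le> transport_cost \<gamma>" using \<gamma>(1) by (rule W2_square_le)
qed

text \<open>A radial homeomorphism onto the open ball of radius 1/2 about the centre of the unit
  box. It brings arbitrary measures into the reach of the space-filling curve; the price is that
  mass might accumulate on the boundary sphere, where \<open>unsquash\<close> is not
  continuous.\<close>

definition squash :: "'a::euclidean_space \<Rightarrow> 'a" where
  "squash x = (1 / 2) *\<^sub>R (One + x /\<^sub>R (1 + norm x))"

definition unsquash :: "'a::euclidean_space \<Rightarrow> 'a" where
  "unsquash z = (2 *\<^sub>R z - One) /\<^sub>R (1 - norm (2 *\<^sub>R z - One))"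

lemma norm_squash: "norm (2 *\<^sub>R squash x - One) < 1"
  by (simp add: squash_def add_pos_nonneg divide_less_eq field_simps)

lemma unsquash_squash [simp]: "unsquash (squash x) = x"
proof -
  have "2 *\<^sub>R squash x - One = x /\<^sub>R (1 + norm x)" by (simp add: squash_def)
  moreover have "1 + norm x \<noteq> 0" using norm_ge_zero[of x] by linarith
  then have "1 - norm (x /\<^sub>R (1 + norm x)) = 1 / (1 + norm x)" 
    by (simp add: field_simps abs_of_nonneg)
  ultimately show ?thesis using \<open>1 + norm x \<noteq> 0\<close> by (simp add: unsquash_def)
qed

lemma squash_in_box: "b \<in> Basis \<Longrightarrow> 0 \<le> squash x \<bullet> b \<and> squash x \<bullet> b < 1"
proof -
  assume b: "b \<in> Basis"
  have "\<bar>(2 *\<^sub>R squash x - One) \<bullet> b\<bar> < 1"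
    using Basis_le_norm[OF b] norm_squash[of x] by (rule le_less_trans)
  then show ?thesis using b by (auto simp: inner_diff_left abs_less_iff)
qed

lemma squash_measurable [measurable]: "squash \<in> borel_measurable borel"
  unfolding squash_def[abs_def] by measurable

lemma unsquash_measurable [measurable]: "unsquash \<in> borel_measurable borel"
  unfolding unsquash_def[abs_def] by measurable

lemma isCont_unsquash: "norm (2 *\<^sub>R z - One) < 1 \<Longrightarrow> isCont unsquash z"
  unfolding unsquash_def[abs_def] by (intro continuous_intros) auto

text \<open>The direct method. All couplings of a minimizing sequence have the same marginals, so
  the limit of the squashed variables has the squashed marginals, which charge only the open ball.
  Hence \<open>unsquash\<close> is continuous at almost every limit point, the limit is again a
  coupling, and Fatou's lemma bounds its cost by the infimum.\<close>

lemma optimal_plan_exists: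
  fixes \<mu> \<nu> :: "'a::euclidean_space measure"
  assumes \<mu>: "\<mu> \<in> P2" and \<nu>: "\<nu> \<in> P2"
  shows "\<exists>\<gamma>. \<gamma> \<in> optimal_plans \<mu> \<nu>"
proof -
  define m where "m = (INF \<gamma>\<in>couplings \<mu> \<nu>. transport_cost \<gamma>)"
  have m_le: "m \<le> transport_cost \<gamma>" if "\<gamma> \<in> couplings \<mu> \<nu>" for \<gamma>
    unfolding m_def using that by (intro cINF_lower bdd_below_transport_cost)
  have "\<exists>\<gamma>\<in>couplings \<mu> \<nu>. transport_cost \<gamma> < m + 1 / Suc n" for n
    using cINF_less_iff[OF couplings_nonempty[OF \<mu> \<nu>] bdd_below_transport_cost, of "m + 1 / Suc n"]
    by (simp add: m_def)
  then obtain g where g: "\<And>n. g n \<in> couplings \<mu> \<nu>" "\<And>n. transport_cost (g n) < m + 1 / Suc n"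
    by metis
  note gD = couplingsD[OF g(1)]
  define E :: "'a \<times> 'a \<Rightarrow> 'a \<times> 'a" where "E z = (squash (fst z), squash (snd z))" for z
  define D :: "'a \<times> 'a \<Rightarrow> 'a \<times> 'a" where "D z = (unsquash (fst z), unsquash (snd z))" for z
  have [measurable]: "E \<in> borel_measurable borel" "D \<in> borel_measurable borel"
    unfolding E_def[abs_def] D_def[abs_def] borel_prod[symmetric] by measurable
  have [measurable]: "E \<in> borel_measurable (g n)" for n
    by (simp cong: measurable_cong_sets add: gD(2))
  define M where "M n = distr (g n) borel E" for n
  have "prob_space (M n)" for n unfolding M_def by (intro prob_space.prob_space_distr gD(1)) simp
  moreover have "sets (M n) = sets borel" for n by (simp add: M_def)
  moreover have "AE z in M n. \<forall>b\<in>Basis. 0 \<le> z \<bullet> b \<and> z \<bullet> b < 1" for n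
    unfolding M_def by (subst AE_distr_iff)
      (auto simp: E_def Basis_prod_def squash_in_box intro!: AE_I2 sets.countable_INT'')
  ultimately have "\<exists>(r :: nat \<Rightarrow> nat) (\<Omega> :: real measure) Z Z0. strict_mono r \<and> prob_space \<Omega> \<and>
    (\<forall>n. Z n \<in> borel_measurable \<Omega>) \<and> Z0 \<in> borel_measurable \<Omega> \<and>
    (\<forall>n. distr \<Omega> borel (Z n) = M (r n)) \<and> (\<forall>\<omega>\<in>space \<Omega>. (\<lambda>n. Z n \<omega>) \<longlonglongrightarrow> Z0 \<omega>)"
    by (rule skorohod_unit_box)
  then obtain r :: "nat \<Rightarrow> nat" and \<Omega> :: "real measure" and Z Z0
    where r: "strict_mono r" and \<Omega>: "prob_space \<Omega>"
    and Z [measurable]: "\<And>n. Z n \<in> borel_measurable \<Omega>" and Z0 [measurable]: "Z0 \<in> borel_measurable \<Omega>"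
    and law: "\<And>n. distr \<Omega> borel (Z n) = M (r n)"
    and lim: "\<And>\<omega>. \<omega> \<in> space \<Omega> \<Longrightarrow> (\<lambda>n. Z n \<omega>) \<longlonglongrightarrow> Z0 \<omega>"
    by blast
  interpret \<Omega>: prob_space \<Omega> by fact
  have fst_snd [measurable]: "fst \<in> borel_measurable (borel :: ('a \<times> 'a) measure)" "snd \<in> borel_measurable (borel :: ('a \<times> 'a) measure)"
    by (auto simp: borel_prod[symmetric])
  have fst_snd' [measurable]: "fst \<in> borel_measurable (g n)" "snd \<in> borel_measurable (g n)" for n
    by (auto cong: measurable_cong_sets simp: gD(2))
  have law_fst: "distr \<Omega> borel (\<lambda>\<omega>. fst (Z n \<omega>)) = distr \<mu> borel squash" for n
  proof -
    have "distr \<Omega> borel (\<lambda>\<omega>. fst (Z n \<omega>)) = distr (M (r n)) borel fst"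
      unfolding law[symmetric] by (subst distr_distr) (auto simp: o_def)
    also have "\<dots> = distr (distr (g (r n)) borel fst) borel squash"
      unfolding M_def by (simp add: distr_distr o_def E_def)
    finally show ?thesis using gD(3) by simp
  qed
  have law_snd: "distr \<Omega> borel (\<lambda>\<omega>. snd (Z n \<omega>)) = distr \<nu> borel squash" for n
  proof -
    have "distr \<Omega> borel (\<lambda>\<omega>. snd (Z n \<omega>)) = distr (M (r n)) borel snd"
      unfolding law[symmetric] by (subst distr_distr) (auto simp: o_def)
    also have "\<dots> = distr (distr (g (r n)) borel snd) borel squash"
      unfolding M_def by (simp add: distr_distr o_def E_def)
    finally show ?thesis using gD(4) by simp
  qed
  have law0_fst: "distr \<Omega> borel (\<lambda>\<omega>. fst (Z0 \<omega>)) = distr \<mu> borel squash"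
    by (rule distr_eq_of_AE_limit[OF \<Omega> _ _ _ law_fst]) (auto intro!: AE_I2 tendsto_fst lim)
  have law0_snd: "distr \<Omega> borel (\<lambda>\<omega>. snd (Z0 \<omega>)) = distr \<nu> borel squash"
    by (rule distr_eq_of_AE_limit[OF \<Omega> _ _ _ law_snd]) (auto intro!: AE_I2 tendsto_snd lim)
  have sq [measurable]: "squash \<in> borel_measurable \<mu>" "squash \<in> borel_measurable \<nu>"
    using P2D(2)[OF \<mu>] P2D(2)[OF \<nu>] by (auto cong: measurable_cong_sets)
  have unsq: "distr (distr \<mu> borel squash) borel unsquash = \<mu>" "distr (distr \<nu> borel squash) borel unsquash = \<nu>"
    using P2D(2)[OF \<mu>] P2D(2)[OF \<nu>] by (auto simp: distr_distr o_def intro!: distr_id2)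
  have inside: "AE \<omega> in \<Omega>. norm (2 *\<^sub>R fst (Z0 \<omega>) - One) < 1" "AE \<omega> in \<Omega>. norm (2 *\<^sub>R snd (Z0 \<omega>) - One) < 1"
  proof -
    have "AE z in distr \<Omega> borel (\<lambda>\<omega>. fst (Z0 \<omega>)). norm (2 *\<^sub>R z - One) < 1"
      unfolding law0_fst by (subst AE_distr_iff) (auto simp: norm_squash)
    then show "AE \<omega> in \<Omega>. norm (2 *\<^sub>R fst (Z0 \<omega>) - One) < 1" by (subst (asm) AE_distr_iff) auto
    have "AE z in distr \<Omega> borel (\<lambda>\<omega>. snd (Z0 \<omega>)). norm (2 *\<^sub>R z - One) < 1"
      unfolding law0_snd by (subst AE_distr_iff) (auto simp: norm_squash)
    then show "AE \<omega> in \<Omega>. norm (2 *\<^sub>R snd (Z0 \<omega>) - One) < 1" by (subst (asm) AE_distr_iff) auto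
  qed
  define h :: "'a \<times> 'a \<Rightarrow> real" where "h z = (norm (fst z - snd z))\<^sup>2" for z
  have [measurable]: "h \<in> borel_measurable borel" unfolding h_def[abs_def] by measurable
  have conv: "AE \<omega> in \<Omega>. (\<lambda>n. h (D (Z n \<omega>))) \<longlonglongrightarrow> h (D (Z0 \<omega>))"
    using inside AE_space
  proof eventually_elim
    case (elim \<omega>)
    show ?case unfolding h_def D_def fst_conv snd_conv
      by (intro tendsto_intros isCont_tendsto_compose[OF isCont_unsquash] tendsto_fst tendsto_snd lim elim)
  qed
  define \<gamma> where "\<gamma> = distr \<Omega> borel (\<lambda>\<omega>. D (Z0 \<omega>))"
  have \<gamma>: "\<gamma> \<in> couplings \<mu> \<nu>"
  proof (rule couplingsI)
    show "prob_space \<gamma>" unfolding \<gamma>_def by (intro \<Omega>.prob_space_distr) simp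
    have "distr \<gamma> borel fst = distr (distr \<Omega> borel (\<lambda>\<omega>. fst (Z0 \<omega>))) borel unsquash"
      unfolding \<gamma>_def by (simp add: distr_distr o_def D_def)
    then show "distr \<gamma> borel fst = \<mu>" by (simp add: law0_fst unsq)
    have "distr \<gamma> borel snd = distr (distr \<Omega> borel (\<lambda>\<omega>. snd (Z0 \<omega>))) borel unsquash"
      unfolding \<gamma>_def by (simp add: distr_distr o_def D_def)
    then show "distr \<gamma> borel snd = \<nu>" by (simp add: law0_snd unsq)
  qed (simp add: \<gamma>_def)
  \<comment> \<open>Fatou's lemma speaks of nonnegative integrals; for couplings of
    \<open>P2\<close> measures they agree with the Bochner integrals of the cost.\<close>
  have cost_nn: "ennreal (transport_cost \<gamma>') = (\<integral>\<^sup>+z. ennreal (h z) \<partial>\<gamma>')" if "\<gamma>' \<in> couplings \<mu> \<nu>" for \<gamma>'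
    unfolding transport_cost_def h_def
    by (rule nn_integral_eq_integral[symmetric, OF integrable_cost[OF that \<mu> \<nu>]]) auto
  have "ennreal (transport_cost \<gamma>) = (\<integral>\<^sup>+\<omega>. ennreal (h (D (Z0 \<omega>))) \<partial>\<Omega>)"
    unfolding cost_nn[OF \<gamma>] unfolding \<gamma>_def by (subst nn_integral_distr) auto
  also have "\<dots> \<le> (\<integral>\<^sup>+\<omega>. liminf (\<lambda>n. ennreal (h (D (Z n \<omega>)))) \<partial>\<Omega>)"
  proof (rule nn_integral_mono_AE)
    show "AE \<omega> in \<Omega>. ennreal (h (D (Z0 \<omega>))) \<le> liminf (\<lambda>n. ennreal (h (D (Z n \<omega>))))"
      using conv
    proof eventually_elim
      case (elim \<omega>)
      then have "(\<lambda>n. ennreal (h (D (Z n \<omega>)))) \<longlonglongrightarrow> ennreal (h (D (Z0 \<omega>)))" by (rule tendsto_ennrealI)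
      then show ?case by (simp add: lim_imp_Liminf)
    qed
  qed
  also have "\<dots> \<le> liminf (\<lambda>n. \<integral>\<^sup>+\<omega>. ennreal (h (D (Z n \<omega>))) \<partial>\<Omega>)"
    by (rule nn_integral_liminf) measurable
  also have "(\<lambda>n. \<integral>\<^sup>+\<omega>. ennreal (h (D (Z n \<omega>))) \<partial>\<Omega>) = (\<lambda>n. ennreal (transport_cost (g (r n))))"
  proof
    fix n
    have "(\<integral>\<^sup>+\<omega>. ennreal (h (D (Z n \<omega>))) \<partial>\<Omega>) = (\<integral>\<^sup>+z. ennreal (h (D z)) \<partial>distr \<Omega> borel (Z n))"
      by (subst nn_integral_distr) auto
    also have "\<dots> = (\<integral>\<^sup>+z. ennreal (h z) \<partial>g (r n))"
      unfolding law M_def by (subst nn_integral_distr) (auto simp: D_def E_def)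
    finally show "(\<integral>\<^sup>+\<omega>. ennreal (h (D (Z n \<omega>))) \<partial>\<Omega>) = ennreal (transport_cost (g (r n)))"
      by (simp add: cost_nn[OF g(1)])
  qed
  also have "liminf (\<lambda>n. ennreal (transport_cost (g (r n)))) \<le> liminf (\<lambda>n. ennreal (m + 1 / Suc n))"
  proof (rule Liminf_mono, rule always_eventually, rule allI, rule ennreal_leI)
    fix n
    have "1 / real (Suc (r n)) \<le> 1 / real (Suc n)"
      using seq_suble[OF r, of n] by (intro divide_left_mono) auto
    then show "transport_cost (g (r n)) \<le> m + 1 / real (Suc n)" using g(2)[of "r n"] by linarith
  qed
  also have "liminf (\<lambda>n. ennreal (m + 1 / Suc n)) = ennreal m"
  proof (rule lim_imp_Liminf)
    have "(\<lambda>n. m + 1 / real (Suc n)) \<longlonglongrightarrow> m + 0"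
      by (intro tendsto_add tendsto_const LIMSEQ_Suc[OF lim_1_over_n])
    then show "(\<lambda>n. ennreal (m + 1 / Suc n)) \<longlonglongrightarrow> ennreal m"
      by (intro tendsto_ennrealI) simp
  qed simp
  finally have "transport_cost \<gamma> \<le> m"
    using INF_transport_cost_nonneg[OF couplings_nonempty[OF \<mu> \<nu>]] unfolding m_def by simp
  then have "\<gamma> \<in> optimal_plans \<mu> \<nu>"
    using \<gamma> m_le by (auto simp: optimal_plans_def is_arg_min_linorder intro: order_trans)
  then show ?thesis ..
qed

section \<open>Optimal maps\<close>

text \<open>Projections of Borel sets need not be Borel, but a closed set is a countable union of
  compact ones, and these have compact projections.\<close>

lemma closed_imp_fst_image_borel:
  fixes K :: "('b::euclidean_space \<times> 'c::euclidean_space) set"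
  assumes "closed K"
  shows "fst ` K \<in> sets borel"
proof -
  have "K = (\<Union>n::nat. K \<inter> cball 0 n)"
    using real_arch_simple by (fastforce simp: mem_cball_0)
  then have "fst ` K = (\<Union>n::nat. fst ` (K \<inter> cball 0 n))" by blast
  also have "\<dots> \<in> sets borel"
  proof (intro sets.countable_UN'' borel_closed compact_imp_closed)
    show "compact (fst ` (K \<inter> cball 0 (real n)))" for n
      by (intro compact_continuous_image continuous_intros closed_Int_compact assms compact_cball)
  qed auto
  finally show ?thesis .
qed

text \<open>The measure of \<open>A\<close> is averaged over its translates by
  \<open>t *\<^sub>R b\<close> with t in [0, 1], all of equal measure. After exchanging the
  integrals the inner one runs along a line, where it vanishes. No splitting of the space into a
  line and a hyperplane is involved.\<close>

lemma null_set_if_countable_on_lines: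
  fixes A :: "'a::euclidean_space set"
  assumes [measurable]: "A \<in> sets borel" and lines: "\<And>x. countable {t::real. x + t *\<^sub>R b \<in> A}"
  shows "A \<in> null_sets lborel"
proof -
  have "emeasure lborel A = (\<integral>\<^sup>+t. indicator {0..1::real} t * emeasure lborel A \<partial>lborel)"
    by (simp add: nn_integral_multc)
  also have "\<dots> = (\<integral>\<^sup>+t. \<integral>\<^sup>+x. indicator {0..1::real} t * indicator A (x + t *\<^sub>R b) \<partial>lborel \<partial>lborel)"
  proof (rule nn_integral_cong)
    fix t :: real
    have "emeasure lborel A = emeasure (distr lborel borel (\<lambda>x. t *\<^sub>R b + x)) A"
      by (simp add: lborel_distr_plus)
    also have "\<dots> = (\<integral>\<^sup>+x. indicator A (x + t *\<^sub>R b) \<partial>lborel)"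
      by (subst nn_integral_indicator[symmetric], simp, subst nn_integral_distr) (auto simp: add.commute)
    finally show "indicator {0..1::real} t * emeasure lborel A
        = (\<integral>\<^sup>+x. indicator {0..1::real} t * indicator A (x + t *\<^sub>R b) \<partial>lborel)"
      by (simp add: nn_integral_cmult)
  qed
  also have "\<dots> = (\<integral>\<^sup>+x. \<integral>\<^sup>+t. indicator {0..1::real} t * indicator A (x + t *\<^sub>R b) \<partial>lborel \<partial>lborel)"
    by (rule lborel_pair.Fubini') measurable
  also have "\<dots> = (\<integral>\<^sup>+(x :: 'a). 0 \<partial>lborel)"
  proof (rule nn_integral_cong)
    fix x :: 'a
    have "(\<integral>\<^sup>+t. indicator {0..1::real} t * indicator A (x + t *\<^sub>R b) \<partial>lborel)
        \<le> (\<integral>\<^sup>+t. indicator {t. x + t *\<^sub>R b \<in> A} t \<partial>lborel)"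
      by (intro nn_integral_mono) (auto simp: indicator_def)
    also have "\<dots> = emeasure lborel {t. x + t *\<^sub>R b \<in> A}"
      by (intro nn_integral_indicator) measurable
    also have "\<dots> = 0" using lines by (rule emeasure_lborel_countable)
    finally show "(\<integral>\<^sup>+t. indicator {0..1::real} t * indicator A (x + t *\<^sub>R b) \<partial>lborel) = 0" by simp
  qed
  finally show ?thesis by (auto simp: null_sets_def)
qed

section \<open>Almost everywhere single-valuedness of closed monotone graphs\<close>

definition monotone_graph :: "('a::real_inner \<times> 'a) set \<Rightarrow> bool" where
  "monotone_graph \<Gamma> \<longleftrightarrow> (\<forall>z\<in>\<Gamma>. \<forall>w\<in>\<Gamma>. 0 \<le> (fst z - fst w) \<bullet> (snd z - snd w))"

definition multivalued_points :: "('a::euclidean_space \<times> 'a) set \<Rightarrow> 'a set" where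
  "multivalued_points \<Gamma> = {x. \<exists>y y'. (x, y) \<in> \<Gamma> \<and> (x, y') \<in> \<Gamma> \<and> y \<noteq> y'}"

lemma multivalued_points_null:
  fixes \<Gamma> :: "('a::euclidean_space \<times> 'a) set"
  assumes closed: "closed \<Gamma>" and mono: "monotone_graph \<Gamma>"
  shows "multivalued_points \<Gamma> \<in> null_sets lborel"
proof -
  define J where "J b = {x. \<exists>y y'. (x, y) \<in> \<Gamma> \<and> (x, y') \<in> \<Gamma> \<and> y \<bullet> b < y' \<bullet> b}" for b
  have J_null: "J b \<in> null_sets lborel" if b: "b \<in> Basis" for b
  proof (rule null_set_if_countable_on_lines)
    \<comment> \<open>The strict inequality in \<open>J b\<close> is not a closed condition; cut
      into gaps of size at least \<open>1 / Suc n\<close> it becomes a countable union of closed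
      ones, so that the projections are Borel.\<close>
    define K where "K n = {p :: 'a \<times> 'a \<times> 'a. (fst p, fst (snd p)) \<in> \<Gamma> \<and> (fst p, snd (snd p)) \<in> \<Gamma> \<and>
      1 / Suc n \<le> snd (snd p) \<bullet> b - fst (snd p) \<bullet> b}" for n
    have "closed (K n)" for n
    proof -
      have "K n = (\<lambda>p. (fst p, fst (snd p))) -` \<Gamma> \<inter> (\<lambda>p. (fst p, snd (snd p))) -` \<Gamma> \<inter>
          {p. 1 / Suc n \<le> snd (snd p) \<bullet> b - fst (snd p) \<bullet> b}"
        by (auto simp: K_def)
      also have "closed \<dots>"
        by (intro closed_Int closed_vimage closed closed_Collect_le continuous_intros)
      finally show ?thesis .
    qed
    then have "(\<Union>n. fst ` K n) \<in> sets borel" by (auto intro: closed_imp_fst_image_borel)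
    moreover have "J b = (\<Union>n. fst ` K n)"
    proof (intro equalityI subsetI)
      fix x assume "x \<in> J b"
      then obtain y y' where y: "(x, y) \<in> \<Gamma>" "(x, y') \<in> \<Gamma>" "y \<bullet> b < y' \<bullet> b" by (auto simp: J_def)
      then obtain n where "1 / Suc n < y' \<bullet> b - y \<bullet> b"
        using nat_approx_posE[of "y' \<bullet> b - y \<bullet> b"] by auto
      then have "(x, y, y') \<in> K n" using y by (auto simp: K_def)
      then show "x \<in> (\<Union>n. fst ` K n)" by force
    next
      fix x assume "x \<in> (\<Union>n. fst ` K n)"
      then obtain n y y' where "(x, y) \<in> \<Gamma>" "(x, y') \<in> \<Gamma>" "1 / Suc n \<le> y' \<bullet> b - y \<bullet> b"
        by (auto simp: K_def)
      moreover have "0 < 1 / real (Suc n)" by simp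
      ultimately show "x \<in> J b" unfolding J_def by (smt (verit) mem_Collect_eq)
    qed
    ultimately show "J b \<in> sets borel" by simp
  next
    fix x :: 'a
    define A where "A = {t::real. x + t *\<^sub>R b \<in> J b}"
    have "\<forall>t\<in>A. \<exists>y y' q. (x + t *\<^sub>R b, y) \<in> \<Gamma> \<and> (x + t *\<^sub>R b, y') \<in> \<Gamma> \<and>
        q \<in> \<rat> \<and> y \<bullet> b < q \<and> q < y' \<bullet> b"
    proof
      fix t assume "t \<in> A"
      then obtain y y' where y: "(x + t *\<^sub>R b, y) \<in> \<Gamma>" "(x + t *\<^sub>R b, y') \<in> \<Gamma>" "y \<bullet> b < y' \<bullet> b"
        by (auto simp: A_def J_def)
      from Rats_dense_in_real[OF y(3)] y show "\<exists>y y' q. (x + t *\<^sub>R b, y) \<in> \<Gamma> \<and> (x + t *\<^sub>R b, y') \<in> \<Gamma> \<and>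
        q \<in> \<rat> \<and> y \<bullet> b < q \<and> q < y' \<bullet> b" by blast
    qed
    then obtain y y' q where q: "\<And>t. t \<in> A \<Longrightarrow> (x + t *\<^sub>R b, y t) \<in> \<Gamma> \<and> (x + t *\<^sub>R b, y' t) \<in> \<Gamma> \<and>
        q t \<in> \<rat> \<and> y t \<bullet> b < q t \<and> q t < y' t \<bullet> b"
      by metis
    \<comment> \<open>Monotonicity between the upper value at \<open>s\<close> and the lower value
      at \<open>t\<close> shows that jump intervals at different parameters do not overlap. A
      rational chosen in each of them therefore determines the parameter.\<close>
    have less: "q s < q t" if "s \<in> A" "t \<in> A" "s < t" for s t
    proof -
      have "0 \<le> ((x + t *\<^sub>R b) - (x + s *\<^sub>R b)) \<bullet> (y t - y' s)"
        using mono q[OF that(1)] q[OF that(2)] unfolding monotone_graph_def by fastforce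
      also have "((x + t *\<^sub>R b) - (x + s *\<^sub>R b)) \<bullet> (y t - y' s) = (t - s) * (y t \<bullet> b - y' s \<bullet> b)"
        by (simp add: algebra_simps inner_commute)
      finally have "y' s \<bullet> b \<le> y t \<bullet> b" using that(3) by (simp add: zero_le_mult_iff)
      then show ?thesis using q[OF that(1)] q[OF that(2)] by linarith
    qed
    have "inj_on q A"
    proof (rule inj_onI)
      fix s t assume st: "s \<in> A" "t \<in> A" "q s = q t"
      then show "s = t" using less[of s t] less[of t s] by (cases s t rule: linorder_cases) auto
    qed
    moreover have "countable (q ` A)" by (rule countable_subset[OF _ countable_rat]) (use q in auto)
    ultimately show "countable {t. x + t *\<^sub>R b \<in> J b}" using countable_image_inj_on unfolding A_def by blast
  qed
  have "multivalued_points \<Gamma> = (\<Union>b\<in>Basis. J b)"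
  proof (intro equalityI subsetI)
    fix x assume "x \<in> multivalued_points \<Gamma>"
    then obtain y y' where y: "(x, y) \<in> \<Gamma>" "(x, y') \<in> \<Gamma>" "y \<noteq> y'" by (auto simp: multivalued_points_def)
    then obtain b where "b \<in> Basis" "y \<bullet> b \<noteq> y' \<bullet> b" using euclidean_eqI by blast
    then have "y \<bullet> b < y' \<bullet> b \<or> y' \<bullet> b < y \<bullet> b" by linarith
    then have "x \<in> J b" unfolding J_def using y by auto
    then show "x \<in> (\<Union>b\<in>Basis. J b)" using \<open>b \<in> Basis\<close> by auto
  qed (auto simp: J_def multivalued_points_def)
  also have "\<dots> \<in> null_sets lborel" using J_null by (intro null_sets_UN') (auto intro: countable_finite)
  finally show ?thesis .
qed

text \<open>The swap preserves the product measure and maps the symmetric set \<open>D\<close> onto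
  itself, so swapping on \<open>D\<close> alone preserves the measure on \<open>D\<close> and,
  trivially, on its complement.\<close>

lemma distr_symmetric_swap:
  assumes \<gamma>: "prob_space \<gamma>" and D: "D \<in> sets (\<gamma> \<Otimes>\<^sub>M \<gamma>)"
    and sym: "\<And>z w. (z, w) \<in> D \<longleftrightarrow> (w, z) \<in> D"
  shows "distr (\<gamma> \<Otimes>\<^sub>M \<gamma>) (\<gamma> \<Otimes>\<^sub>M \<gamma>) (\<lambda>p. if p \<in> D then (snd p, fst p) else p) = \<gamma> \<Otimes>\<^sub>M \<gamma>"
proof -
  interpret prob_space \<gamma> by fact
  interpret P: pair_prob_space \<gamma> \<gamma> ..
  let ?P = "\<gamma> \<Otimes>\<^sub>M \<gamma>"
  define \<sigma> where "\<sigma> p = (if p \<in> D then (snd p, fst p) else p)" for p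
  note D [measurable]
  have \<sigma> [measurable]: "\<sigma> \<in> measurable ?P ?P" unfolding \<sigma>_def[abs_def] by measurable
  have swap: "emeasure ?P ((\<lambda>p. (snd p, fst p)) -` A \<inter> space ?P) = emeasure ?P A" if "A \<in> sets ?P" for A
  proof -
    have "emeasure (distr ?P ?P (\<lambda>(x, y). (y, x))) A = emeasure ?P ((\<lambda>(x, y). (y, x)) -` A \<inter> space ?P)"
      using that by (intro emeasure_distr) auto
    moreover have "(\<lambda>(x, y). (y, x)) -` A = (\<lambda>p. (snd p, fst p)) -` A" by (auto simp: case_prod_beta)
    ultimately show ?thesis using P.distr_pair_swap by simp
  qed
  have "distr ?P ?P \<sigma> = ?P"
  proof (rule measure_eqI)
    fix A assume "A \<in> sets (distr ?P ?P \<sigma>)"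
    then have A [measurable]: "A \<in> sets ?P" by simp
    have "emeasure (distr ?P ?P \<sigma>) A = emeasure ?P (\<sigma> -` A \<inter> space ?P)"
      by (rule emeasure_distr) auto
    also have "\<sigma> -` A \<inter> space ?P = ((\<lambda>p. (snd p, fst p)) -` (D \<inter> A) \<inter> space ?P) \<union> (A - D)"
      using sets.sets_into_space[OF A] sets.sets_into_space[OF D] sym
      by (auto simp: \<sigma>_def space_pair_measure split: if_splits)
    also have "emeasure ?P \<dots> = emeasure ?P ((\<lambda>p. (snd p, fst p)) -` (D \<inter> A) \<inter> space ?P) + emeasure ?P (A - D)"
    proof (rule plus_emeasure[symmetric])
      show "(\<lambda>p. (snd p, fst p)) -` (D \<inter> A) \<inter> space ?P \<in> sets ?P"
        by (rule measurable_sets[of _ _ ?P]) auto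
    qed (use sym in auto)
    also have "\<dots> = emeasure ?P (D \<inter> A) + emeasure ?P (A - D)" by (subst swap) auto
    also have "\<dots> = emeasure ?P A"
      by (subst plus_emeasure) (auto intro!: arg_cong[of _ _ "emeasure ?P"])
    finally show "emeasure (distr ?P ?P \<sigma>) A = emeasure ?P A" .
  qed simp
  then show ?thesis unfolding \<sigma>_def[abs_def] .
qed

text \<open>Among two independent samples \<open>(x, y)\<close>, \<open>(x', y')\<close> of an optimal plan, exchanging
  \<open>y\<close> and \<open>y'\<close> exactly when this lowers the total cost preserves both marginals, because the
  exchange region is symmetric. Optimality thus makes this region null.\<close>

lemma optimal_plan_monotone_AE:
  fixes \<gamma> :: "('a::euclidean_space \<times> 'a) measure"
  assumes opt: "\<gamma> \<in> optimal_plans \<mu> \<nu>" and \<mu>: "\<mu> \<in> P2" and \<nu>: "\<nu> \<in> P2"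
  shows "AE p in \<gamma> \<Otimes>\<^sub>M \<gamma>. 0 \<le> (fst (fst p) - fst (snd p)) \<bullet> (snd (fst p) - snd (snd p))"
proof -
  have \<gamma>: "\<gamma> \<in> couplings \<mu> \<nu>" and le: "\<And>\<gamma>'. \<gamma>' \<in> couplings \<mu> \<nu> \<Longrightarrow> transport_cost \<gamma> \<le> transport_cost \<gamma>'"
    using opt by (auto simp: optimal_plans_def is_arg_min_linorder)
  note \<gamma>D = couplingsD[OF \<gamma>]
  interpret prob_space \<gamma> by (rule \<gamma>D)
  interpret P: pair_prob_space \<gamma> \<gamma> ..
  let ?P = "\<gamma> \<Otimes>\<^sub>M \<gamma>"
  have sP: "sets ?P = sets ((borel \<Otimes>\<^sub>M borel) \<Otimes>\<^sub>M (borel \<Otimes>\<^sub>M borel))"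
    by (intro sets_pair_measure_cong) (simp_all only: \<gamma>D(2) borel_prod)
  have spP: "space ?P = UNIV" using sets_eq_imp_space_eq[OF sP] by (simp add: space_pair_measure)
  have mP: "f \<in> measurable ?P N" if "f \<in> measurable ((borel \<Otimes>\<^sub>M borel) \<Otimes>\<^sub>M (borel \<Otimes>\<^sub>M borel)) N"
    for f :: "_ \<Rightarrow> 'z" and N using that by (simp cong: measurable_cong_sets add: sP)
  define k where "k p = (fst (fst p) - fst (snd p)) \<bullet> (snd (fst p) - snd (snd p))" for p :: "('a \<times> 'a) \<times> ('a \<times> 'a)"
  define D where "D = {p. k p < 0}"
  have k [measurable]: "k \<in> borel_measurable ?P" by (rule mP) (simp add: k_def[abs_def])
  have "D = {p \<in> space ?P. k p < 0}" by (simp add: D_def spP)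
  then have D [measurable]: "D \<in> sets ?P" by simp
  have sym: "(z, w) \<in> D \<longleftrightarrow> (w, z) \<in> D" for z w
    by (simp add: D_def k_def algebra_simps)
  define \<sigma> where "\<sigma> p = (if p \<in> D then (snd p, fst p) else p)" for p
  have \<sigma> [measurable]: "\<sigma> \<in> measurable ?P ?P" unfolding \<sigma>_def[abs_def] by measurable
  have \<sigma>_law: "distr ?P ?P \<sigma> = ?P"
    unfolding \<sigma>_def[abs_def] by (rule distr_symmetric_swap[OF _ D sym]) (rule prob_space_axioms)
  have fst_law: "distr ?P \<gamma> fst = \<gamma>" using distr_pair_fst[of \<gamma>] emeasure_space_1 by simp
  have m [measurable]: "fst \<in> borel_measurable \<gamma>" "snd \<in> borel_measurable \<gamma>"
    using \<gamma>D(2) by (auto cong: measurable_cong_sets simp: borel_prod[symmetric])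
  have snd_law: "distr ?P borel (\<lambda>p. snd (fst p)) = \<nu>"
  proof -
    have "distr ?P borel (\<lambda>p. snd (fst p)) = distr (distr ?P \<gamma> fst) borel snd"
      by (simp add: distr_distr o_def)
    then show ?thesis using fst_law \<gamma>D(4) by simp
  qed
  have f1: "distr ?P borel (\<lambda>p. fst (fst p)) = \<mu>"
  proof -
    have "distr ?P borel (\<lambda>p. fst (fst p)) = distr (distr ?P \<gamma> fst) borel fst"
      by (simp add: distr_distr o_def)
    then show ?thesis using fst_law \<gamma>D(3) by simp
  qed
  have f2: "distr ?P borel (\<lambda>p. snd (fst (\<sigma> p))) = \<nu>"
  proof -
    have "distr ?P borel (\<lambda>p. snd (fst (\<sigma> p))) = distr (distr ?P ?P \<sigma>) borel (\<lambda>p. snd (fst p))"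
      by (simp add: distr_distr o_def)
    then show ?thesis by (simp add: \<sigma>_law snd_law)
  qed
  define \<gamma>' where "\<gamma>' = distr ?P (borel \<Otimes>\<^sub>M borel) (\<lambda>p. (fst (fst p), snd (fst (\<sigma> p))))"
  have \<gamma>': "\<gamma>' \<in> couplings \<mu> \<nu>"
    unfolding \<gamma>'_def f1[symmetric] f2[symmetric] by (rule distr_in_couplings) (auto intro: P.prob_space_axioms)
  define h :: "'a \<times> 'a \<Rightarrow> real" where "h z = (norm (fst z - snd z))\<^sup>2" for z
  have [measurable]: "h \<in> borel_measurable (borel \<Otimes>\<^sub>M borel)" unfolding h_def[abs_def] by measurable
  have [measurable]: "h \<in> borel_measurable \<gamma>" unfolding h_def[abs_def] by measurable
  have c1: "transport_cost \<gamma> = (\<integral>p. h (fst p) \<partial>?P)" "integrable ?P (\<lambda>p. h (fst p))"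
  proof -
    have "transport_cost \<gamma> = (\<integral>z. h z \<partial>distr ?P \<gamma> fst)" by (simp add: fst_law transport_cost_def h_def)
    also have "\<dots> = (\<integral>p. h (fst p) \<partial>?P)" by (rule integral_distr) auto
    finally show "transport_cost \<gamma> = (\<integral>p. h (fst p) \<partial>?P)" .
    have "integrable (distr ?P \<gamma> fst) h"
      unfolding fst_law using integrable_cost[OF \<gamma> \<mu> \<nu>] by (simp add: h_def[abs_def])
    then show "integrable ?P (\<lambda>p. h (fst p))" by (subst (asm) integrable_distr_eq) auto
  qed
  have c2: "transport_cost \<gamma>' = (\<integral>p. h (fst (fst p), snd (fst (\<sigma> p))) \<partial>?P)"
      "integrable ?P (\<lambda>p. h (fst (fst p), snd (fst (\<sigma> p))))"
  proof -
    have "transport_cost \<gamma>' = (\<integral>z. h z \<partial>\<gamma>')" by (simp add: transport_cost_def h_def)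
    also have "\<dots> = (\<integral>p. h (fst (fst p), snd (fst (\<sigma> p))) \<partial>?P)"
      unfolding \<gamma>'_def by (rule integral_distr) auto
    finally show "transport_cost \<gamma>' = (\<integral>p. h (fst (fst p), snd (fst (\<sigma> p))) \<partial>?P)" .
    have "integrable \<gamma>' h" using integrable_cost[OF \<gamma>' \<mu> \<nu>] by (simp add: h_def[abs_def])
    then show "integrable ?P (\<lambda>p. h (fst (fst p), snd (fst (\<sigma> p))))"
      unfolding \<gamma>'_def by (subst (asm) integrable_distr_eq) auto
  qed
  \<comment> \<open>\<open>\<gamma>'\<close> records only the first of the two pairs after the
    exchange, so \<open>q\<close> is the saving on that pair alone and has no definite sign.\<close>
  define q where "q p = h (fst p) - h (fst (fst p), snd (fst (\<sigma> p)))" for p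
  have q_int: "integrable ?P q" unfolding q_def[abs_def] by (intro Bochner_Integration.integrable_diff c1 c2)
  have q_le: "integral\<^sup>L ?P q \<le> 0"
    using le[OF \<gamma>'] unfolding q_def[abs_def]
    by (subst Bochner_Integration.integral_diff[OF c1(2) c2(2)]) (simp add: c1(1)[symmetric] c2(1)[symmetric])
  have qm [measurable]: "q \<in> borel_measurable ?P" using q_int by auto
  have swap_int: "integrable ?P (\<lambda>(x, y). q (y, x))" "(\<integral>(x, y). q (y, x) \<partial>?P) = integral\<^sup>L ?P q"
    using P.integrable_product_swap[OF q_int] P.integral_product_swap[OF qm] by auto
  \<comment> \<open>Adding the saving on the second pair gives the total saving of the exchange: the
    squares cancel and only the mixed terms, \<open>- 2 * k p\<close>, remain. Both savings have the
    same integral, which optimality makes nonpositive, while the total is nonnegative by the choice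
    of \<open>D\<close>.\<close>
  have sum: "q p + (case p of (x, y) \<Rightarrow> q (y, x)) = (if p \<in> D then - 2 * k p else 0)" for p
  proof (cases "p \<in> D")
    case True
    obtain x y x' y' where p: "p = ((x, y), (x', y'))" by (metis prod.collapse)
    show ?thesis using True sym[of "(x, y)" "(x', y')"]
      by (simp add: p q_def h_def \<sigma>_def k_def power2_norm_eq_inner algebra_simps inner_commute)
  next
    case False
    obtain x y x' y' where p: "p = ((x, y), (x', y'))" by (metis prod.collapse)
    show ?thesis using False sym[of "(x, y)" "(x', y')"]
      by (simp add: p q_def \<sigma>_def)
  qed
  have int: "integrable ?P (\<lambda>p. if p \<in> D then - 2 * k p else 0)"
    unfolding sum[symmetric] using q_int swap_int(1) by (rule Bochner_Integration.integrable_add)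
  have "(\<integral>p. (if p \<in> D then - 2 * k p else 0) \<partial>?P) = integral\<^sup>L ?P q + integral\<^sup>L ?P q"
    unfolding sum[symmetric] using Bochner_Integration.integral_add[OF q_int swap_int(1)] swap_int(2) by simp
  also have "\<dots> \<le> 0" using q_le by simp
  finally have "(\<integral>p. (if p \<in> D then - 2 * k p else 0) \<partial>?P) \<le> 0" .
  moreover have "0 \<le> (\<integral>p. (if p \<in> D then - 2 * k p else 0) \<partial>?P)"
    by (rule Bochner_Integration.integral_nonneg) (auto simp: D_def)
  ultimately have "(\<integral>p. (if p \<in> D then - 2 * k p else 0) \<partial>?P) = 0" by linarith
  then have "AE p in ?P. (if p \<in> D then - 2 * k p else 0) = 0"
    by (subst (asm) integral_nonneg_eq_0_iff_AE[OF int]) (auto simp: D_def)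
  then have "AE p in ?P. 0 \<le> k p" by eventually_elim (auto simp: D_def split: if_splits)
  then show ?thesis by (simp add: k_def)
qed

section \<open>Supports of optimal plans\<close>

definition measure_support :: "'b::topological_space measure \<Rightarrow> 'b set" where
  "measure_support M = {x. \<forall>U. open U \<longrightarrow> x \<in> U \<longrightarrow> emeasure M U \<noteq> 0}"

lemma closed_measure_support: "closed (measure_support M)"
proof -
  have "- measure_support M = \<Union>{U. open U \<and> emeasure M U = 0}"
    by (auto simp: measure_support_def)
  moreover have "open (\<Union>{U. open U \<and> emeasure M U = 0})" by auto
  ultimately show ?thesis by (simp add: closed_def)
qed

text \<open>The complement of the support is a union of possibly uncountably many open null sets; by
  the Lindelof property countably many of them suffice.\<close>

lemma AE_measure_support:
  fixes M :: "'b::second_countable_topology measure"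
  assumes "sets M = sets borel"
  shows "AE x in M. x \<in> measure_support M"
proof -
  obtain F' where F': "F' \<subseteq> {U. open U \<and> emeasure M U = 0}" "countable F'"
    "\<Union>F' = \<Union>{U. open U \<and> emeasure M U = 0}"
    using Lindelof[of "{U. open U \<and> emeasure M U = 0}"] by auto
  have "(\<Union>U\<in>F'. U) \<in> null_sets M"
    using F'(1,2) assms by (intro null_sets_UN') (auto simp: null_sets_def)
  then have "AE x in M. x \<notin> \<Union>F'" using AE_not_in by fastforce
  then show ?thesis unfolding F'(3) by eventually_elim (auto simp: measure_support_def)
qed

text \<open>Violating monotonicity is an open condition on pairs of points. A violating pair in the
  support would have a product neighbourhood \<open>U \<times> V\<close> of violating pairs, null by
  the almost-everywhere statement although both factors have positive measure.\<close>

lemma optimal_plan_support_monotone: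
  fixes \<gamma> :: "('a::euclidean_space \<times> 'a) measure"
  assumes opt: "\<gamma> \<in> optimal_plans \<mu> \<nu>" and \<mu>: "\<mu> \<in> P2" and \<nu>: "\<nu> \<in> P2"
  shows "monotone_graph (measure_support \<gamma>)"
  unfolding monotone_graph_def
proof (intro ballI, rule ccontr)
  fix z w assume z: "z \<in> measure_support \<gamma>" and w: "w \<in> measure_support \<gamma>"
  assume neg: "\<not> 0 \<le> (fst z - fst w) \<bullet> (snd z - snd w)"
  have \<gamma>: "\<gamma> \<in> couplings \<mu> \<nu>" using opt by (auto simp: optimal_plans_def is_arg_min_def)
  note \<gamma>D = couplingsD[OF \<gamma>]
  interpret prob_space \<gamma> by (rule \<gamma>D)
  let ?D = "{p :: ('a \<times> 'a) \<times> 'a \<times> 'a. (fst (fst p) - fst (snd p)) \<bullet> (snd (fst p) - snd (snd p)) < 0}"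
  have "open ?D" by (intro open_Collect_less continuous_intros)
  moreover have "(z, w) \<in> ?D" using neg by simp
  ultimately obtain U V where UV: "open U" "open V" "(z, w) \<in> U \<times> V" "U \<times> V \<subseteq> ?D"
    by (rule open_prod_elim)
  have m: "U \<in> sets \<gamma>" "V \<in> sets \<gamma>" using UV \<gamma>D(2) by auto
  have "AE p in \<gamma> \<Otimes>\<^sub>M \<gamma>. p \<notin> U \<times> V"
    using optimal_plan_monotone_AE[OF opt \<mu> \<nu>] by eventually_elim (use UV(4) in force)
  then have "emeasure (\<gamma> \<Otimes>\<^sub>M \<gamma>) (U \<times> V) = 0"
    using m by (subst (asm) AE_iff_measurable[of "U \<times> V"])
      (auto simp: space_pair_measure dest: sets.sets_into_space)
  then have "emeasure \<gamma> U * emeasure \<gamma> V = 0" using m by (simp add: emeasure_pair_measure_Times)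
  then show False using z w UV by (auto simp: measure_support_def)
qed

text \<open>The existence half of Brenier's theorem. The support of an optimal plan is single-valued
  off a Lebesgue null set of base points; absolute continuity makes that set \<mu>-null, so the plan
  is concentrated on the graph of a map.\<close>

theorem optimal_map_exists:
  fixes \<mu> \<nu> :: "'a::euclidean_space measure"
  assumes \<mu>: "\<mu> \<in> P2abs" and \<nu>: "\<nu> \<in> P2"
  shows "\<exists>T. is_optimal_map \<mu> \<nu> T"
proof -
  have \<mu>2: "\<mu> \<in> P2" and ac: "absolutely_continuous lborel \<mu>" using \<mu> by (auto simp: P2abs_def)
  obtain \<gamma> where opt: "\<gamma> \<in> optimal_plans \<mu> \<nu>" using optimal_plan_exists[OF \<mu>2 \<nu>] by auto
  then have \<gamma>: "\<gamma> \<in> couplings \<mu> \<nu>" by (auto simp: optimal_plans_def is_arg_min_def)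
  note \<gamma>D = couplingsD[OF \<gamma>]
  define \<Gamma> where "\<Gamma> = measure_support \<gamma>"
  define N where "N = multivalued_points \<Gamma>"
  have \<Gamma>: "closed \<Gamma>" "monotone_graph \<Gamma>" "AE z in \<gamma>. z \<in> \<Gamma>"
    unfolding \<Gamma>_def
    by (fact closed_measure_support optimal_plan_support_monotone[OF opt \<mu>2 \<nu>] AE_measure_support[OF \<gamma>D(2)])+
  have N_null: "N \<in> null_sets lborel" unfolding N_def by (intro multivalued_points_null \<Gamma>)
  then have N_meas: "N \<in> sets borel" by auto
  define T where "T x = (if x \<in> fst ` \<Gamma> - N then THE y. (x, y) \<in> \<Gamma> else 0)" for x
  have T_eq: "T x = y" if "(x, y) \<in> \<Gamma>" "x \<notin> N" for x y
  proof -
    have "(THE y. (x, y) \<in> \<Gamma>) = y"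
      using that by (intro the_equality) (auto simp: N_def multivalued_points_def)
    then show ?thesis using that by (force simp: T_def)
  qed
  have T [measurable]: "T \<in> borel_measurable borel"
    unfolding borel_eq_closed
  proof (rule measurable_measure_of)
    fix C :: "'a set" assume "C \<in> Collect closed"
    then have C: "closed C" by simp
    \<comment> \<open>Measurability is tested on closed sets because then the relevant part of the
      graph is closed and its projection is Borel.\<close>
    have "closed (\<Gamma> \<inter> UNIV \<times> C)" by (intro closed_Int closed_Times C \<Gamma>) auto
    then have "fst ` (\<Gamma> \<inter> UNIV \<times> C) \<in> sets borel" "fst ` \<Gamma> \<in> sets borel"
      by (intro closed_imp_fst_image_borel \<Gamma>, assumption) (intro closed_imp_fst_image_borel \<Gamma>)
    moreover have "T -` C = (fst ` (\<Gamma> \<inter> UNIV \<times> C) - N) \<union> (if 0 \<in> C then - (fst ` \<Gamma> - N) else {})"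
    proof (intro set_eqI)
      fix x
      show "x \<in> T -` C \<longleftrightarrow> x \<in> (fst ` (\<Gamma> \<inter> UNIV \<times> C) - N) \<union> (if 0 \<in> C then - (fst ` \<Gamma> - N) else {})"
      proof (cases "x \<in> fst ` \<Gamma> - N")
        case True
        then obtain y where y: "(x, y) \<in> \<Gamma>" "x \<notin> N" by auto
        have uniq: "y' = y" if "(x, y') \<in> \<Gamma>" for y' using T_eq[OF that y(2)] T_eq[OF y] by simp
        have "x \<in> fst ` (\<Gamma> \<inter> UNIV \<times> C) \<longleftrightarrow> y \<in> C"
        proof
          assume "x \<in> fst ` (\<Gamma> \<inter> UNIV \<times> C)"
          then obtain y' where "(x, y') \<in> \<Gamma>" "y' \<in> C" by auto
          then show "y \<in> C" using uniq by blast
        next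
          assume "y \<in> C"
          then show "x \<in> fst ` (\<Gamma> \<inter> UNIV \<times> C)" by (intro rev_image_eqI[of "(x, y)"]) (use y in auto)
        qed
        moreover have "x \<notin> - (fst ` \<Gamma> - N)" using True by simp
        ultimately show ?thesis using T_eq[OF y] y(2) by simp
      next
        case False
        then have "T x = 0" unfolding T_def by (simp only: if_False)
        moreover have "x \<notin> fst ` (\<Gamma> \<inter> UNIV \<times> C) - N" using False by blast
        ultimately show ?thesis using False by simp
      qed
    qed
    ultimately show "T -` C \<inter> space (sigma UNIV (Collect closed)) \<in> sets (sigma UNIV (Collect closed))"
      using N_meas unfolding borel_eq_closed[symmetric]
      by (cases "0 \<in> C") (simp_all add: sets.Un sets.Diff borel_comp)
  qed auto
  have m [measurable]: "fst \<in> borel_measurable \<gamma>" "snd \<in> borel_measurable \<gamma>"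
    using \<gamma>D(2) by (auto cong: measurable_cong_sets simp: borel_prod[symmetric])
  have "N \<in> null_sets \<mu>" using N_null ac by (auto simp: absolutely_continuous_def)
  then have "AE x in distr \<gamma> borel fst. x \<notin> N" unfolding \<gamma>D(3) by (rule AE_not_in)
  then have "AE z in \<gamma>. fst z \<notin> N"
    using N_meas by (subst (asm) AE_distr_iff) (auto intro: borel_comp)
  with \<Gamma>(3) have graph: "AE z in \<gamma>. z = (fst z, T (fst z))"
    by eventually_elim (auto simp: T_eq)
  have "distr \<mu> (borel \<Otimes>\<^sub>M borel) (\<lambda>x. (x, T x)) = distr \<gamma> (borel \<Otimes>\<^sub>M borel) (\<lambda>z. (fst z, T (fst z)))"
    by (subst \<gamma>D(3)[symmetric]) (simp add: distr_distr o_def)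
  also have "\<dots> = distr \<gamma> (borel \<Otimes>\<^sub>M borel) (\<lambda>z. z)"
  proof (rule distr_cong_AE)
    show "AE z in \<gamma>. (fst z, T (fst z)) = z" using graph by eventually_elim simp
    show "(\<lambda>z. z) \<in> measurable \<gamma> (borel \<Otimes>\<^sub>M borel)"
      by (rule measurable_ident_sets) (simp only: \<gamma>D(2) borel_prod)
    show "(\<lambda>z. (fst z, T (fst z))) \<in> measurable \<gamma> (borel \<Otimes>\<^sub>M borel)" by measurable
  qed auto
  also have "\<dots> = \<gamma>" by (intro distr_id2) (simp only: \<gamma>D(2) borel_prod)
  finally have plan: "distr \<mu> (borel \<Otimes>\<^sub>M borel) (\<lambda>x. (x, T x)) = \<gamma>" .
  have "distr \<mu> borel T = distr \<gamma> borel (\<lambda>z. T (fst z))"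
    by (subst \<gamma>D(3)[symmetric]) (simp add: distr_distr o_def)
  also have "\<dots> = distr \<gamma> borel snd"
    using graph by (intro distr_cong_AE) (auto elim!: eventually_mono simp: prod_eq_iff)
  finally have "distr \<mu> borel T = \<nu>" by (simp add: \<gamma>D)
  then have "is_optimal_map \<mu> \<nu> T" unfolding is_optimal_map_def plan using T opt by blast
  then show ?thesis by (rule exI[of "is_optimal_map \<mu> \<nu>" T])
qed

section \<open>The forward-backward step\<close>

lemma subdifferential_monotone:
  assumes "s \<in> subdifferential H x" "t \<in> subdifferential H y"
  shows "0 \<le> (s - t) \<bullet> (x - y)"
proof -
  have "H x + s \<bullet> (y - x) \<le> H y" "H y + t \<bullet> (x - y) \<le> H x"
    using assms by (auto simp: subdifferential_def)
  then show ?thesis by (simp add: algebra_simps)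
qed

text \<open>The subgradient inequality is tested at a point that lies, for nonzero \<open>s\<close>,
  at distance 1 + r from \<open>x\<close> in the direction of \<open>s\<close>: quadratic growth
  divided by a linear distance leaves linear growth. The bound a (5 r^2 + 4 r + 3) obtained for (1 +
  r) times the norm of \<open>s\<close> is at most 5 a (1 + r)^2, whence the constant 5. Linear
  growth is what makes \<open>S\<close> square integrable against measures in
  \<open>P2\<close>.\<close>

lemma subgradient_norm_le:
  fixes H :: "'a::euclidean_space \<Rightarrow> real"
  assumes growth: "\<And>x. \<bar>H x\<bar> \<le> a * ((norm x)\<^sup>2 + 1)" and a: "0 < a" and s: "s \<in> subdifferential H x"
  shows "norm s \<le> 5 * a * (1 + norm x)"
proof -
  define r where "r = norm x"
  have r: "0 \<le> r" by (simp add: r_def)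
  define y where "y = x + (1 + r) *\<^sub>R sgn s"
  have ss: "s \<bullet> sgn s = norm s"
    by (cases "s = 0") (simp_all add: sgn_div_norm dot_square_norm power2_eq_square)
  have "norm y \<le> norm x + norm ((1 + r) *\<^sub>R sgn s)" unfolding y_def by (rule norm_triangle_ineq)
  also have "\<dots> \<le> r + (1 + r)" using r by (auto simp: r_def norm_sgn)
  finally have "norm y \<le> 1 + 2 * r" by simp
  then have "(norm y)\<^sup>2 \<le> (1 + 2 * r)\<^sup>2" by (intro power_mono) auto
  then have "a * ((norm y)\<^sup>2 + 1) \<le> a * ((1 + 2 * r)\<^sup>2 + 1)" using a by simp
  moreover have "H x + s \<bullet> (y - x) \<le> H y" using s by (auto simp: subdifferential_def)
  moreover have "s \<bullet> (y - x) = (1 + r) * norm s" by (simp add: y_def ss)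
  moreover have "H y \<le> a * ((norm y)\<^sup>2 + 1)" "- H x \<le> a * (r\<^sup>2 + 1)"
    using growth[of x] growth[of y] by (auto simp: r_def)
  ultimately have "(1 + r) * norm s \<le> a * ((1 + 2 * r)\<^sup>2 + 1) + a * (r\<^sup>2 + 1)" by linarith
  also have "\<dots> = (1 + r) * (5 * a * (1 + r)) - a * (6 * r + 2)"
    by (simp add: power2_eq_square algebra_simps)
  also have "\<dots> \<le> (1 + r) * (5 * a * (1 + r))" using a r by simp
  finally have "(1 + r) * norm s \<le> (1 + r) * (5 * a * (1 + r))" .
  then show ?thesis unfolding r_def[symmetric] by (rule mult_left_le_imp_le) (use r in auto)
qed

locale subgradient_selection =
  fixes H :: "'a::euclidean_space \<Rightarrow> real" and S :: "'a \<Rightarrow> 'a" and \<eta> :: real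
  assumes H_convex: "convex_on UNIV H" and H_growth: "quadratic_growth H"
    and S_meas [measurable]: "S \<in> borel_measurable borel" and S_sub: "\<And>x. S x \<in> subdifferential H x"
    and \<eta>_pos: "0 < \<eta>"
begin

definition forward_step :: "'a measure \<Rightarrow> 'a measure" where
  "forward_step \<mu> = distr \<mu> borel (\<lambda>x. x + \<eta> *\<^sub>R S x)"

lemma H_meas [measurable]: "H \<in> borel_measurable borel"
  using convex_on_continuous[OF open_UNIV H_convex] by (rule borel_measurable_continuous_onI)

lemma integrable_H:
  assumes "\<mu> \<in> P2"
  shows "integrable \<mu> H"
proof -
  obtain a where a: "0 < a" "\<And>x. \<bar>H x\<bar> \<le> a * ((norm x)\<^sup>2 + 1)"
    using H_growth by (auto simp: quadratic_growth_def)
  interpret prob_space \<mu> by (rule P2D[OF assms])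
  show ?thesis
  proof (rule Bochner_Integration.integrable_bound)
    show "integrable \<mu> (\<lambda>x. a * ((norm x)\<^sup>2 + 1))" using P2D(4)[OF assms] by simp
    show "H \<in> borel_measurable \<mu>" using P2D(2)[OF assms] H_meas by (simp cong: measurable_cong_sets)
    show "AE x in \<mu>. norm (H x) \<le> norm (a * ((norm x)\<^sup>2 + 1))"
      using a by (auto intro!: always_eventually simp: abs_mult)
  qed
qed

lemma integrable_S_square:
  assumes "\<mu> \<in> P2"
  shows "integrable \<mu> (\<lambda>x. (norm (S x))\<^sup>2)"
proof -
  obtain a where a: "0 < a" "\<And>x. \<bar>H x\<bar> \<le> a * ((norm x)\<^sup>2 + 1)"
    using H_growth by (auto simp: quadratic_growth_def)
  interpret prob_space \<mu> by (rule P2D[OF assms])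
  have bound: "(norm (S x))\<^sup>2 \<le> 50 * a\<^sup>2 * ((norm x)\<^sup>2 + 1)" for x
  proof -
    have "norm (S x) \<le> 5 * a * (1 + norm x)" by (rule subgradient_norm_le[OF a(2,1) S_sub])
    then have "(norm (S x))\<^sup>2 \<le> (5 * a * (1 + norm x))\<^sup>2" by (intro power_mono) auto
    also have "\<dots> = 25 * a\<^sup>2 * (1 + norm x)\<^sup>2" by (simp add: power_mult_distrib)
    also have "\<dots> \<le> 25 * a\<^sup>2 * (2 * ((norm x)\<^sup>2 + 1))"
    proof (rule mult_left_mono)
      have "0 \<le> (1 - norm x)\<^sup>2" by simp
      then show "(1 + norm x)\<^sup>2 \<le> 2 * ((norm x)\<^sup>2 + 1)" by (simp add: power2_eq_square algebra_simps)
    qed simp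
    finally show ?thesis by (simp add: algebra_simps)
  qed
  show ?thesis
  proof (rule Bochner_Integration.integrable_bound)
    show "integrable \<mu> (\<lambda>x. 50 * a\<^sup>2 * ((norm x)\<^sup>2 + 1))" using P2D(4)[OF assms] by simp
    show "(\<lambda>x. (norm (S x))\<^sup>2) \<in> borel_measurable \<mu>"
      using P2D(2)[OF assms] by (simp cong: measurable_cong_sets)
    show "AE x in \<mu>. norm ((norm (S x))\<^sup>2) \<le> norm (50 * a\<^sup>2 * ((norm x)\<^sup>2 + 1))"
      using bound by (auto intro!: always_eventually)
  qed
qed

text \<open>By monotonicity of \<open>S\<close> the forward step expands distances. Its nonexpansive inverse is
  extended to the closure of the range, which, unlike the range itself, is visibly Borel.\<close>

lemma forward_inverse:
  "\<exists>J\<in>borel_measurable borel. \<forall>x. J (x + \<eta> *\<^sub>R S x) = x"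
proof -
  define f where "f x = x + \<eta> *\<^sub>R S x" for x
  have expand: "norm (x - y) \<le> norm (f x - f y)" for x y
  proof -
    \<comment> \<open>The cross term is nonnegative by monotonicity of the subdifferential, whatever
      the size of the step \<open>\<eta>\<close>.\<close>
    have "(norm (f x - f y))\<^sup>2 = (norm (x - y))\<^sup>2 + 2 * \<eta> * ((S x - S y) \<bullet> (x - y)) + \<eta>\<^sup>2 * (norm (S x - S y))\<^sup>2"
      unfolding f_def power2_norm_eq_inner
      by (simp add: algebra_simps inner_commute power2_eq_square)
    moreover have "0 \<le> 2 * \<eta> * ((S x - S y) \<bullet> (x - y))"
      using subdifferential_monotone[OF S_sub S_sub, of x y] \<eta>_pos by simp
    ultimately have "(norm (x - y))\<^sup>2 \<le> (norm (f x - f y))\<^sup>2" by simp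
    then show ?thesis by (rule power2_le_imp_le) simp
  qed
  then have "inj f" by (metis injI norm_le_zero_iff right_minus_eq norm_zero)
  have "uniformly_continuous_on (range f) (inv f)"
    unfolding uniformly_continuous_on_def
  proof (intro allI impI)
    fix e :: real assume "0 < e"
    then show "\<exists>d>0. \<forall>x\<in>range f. \<forall>x'\<in>range f. dist x' x < d \<longrightarrow> dist (inv f x') (inv f x) < e"
      using expand by (intro exI[of _ e]) (auto simp: \<open>inj f\<close> dist_norm intro: le_less_trans)
  qed
  then obtain g where g: "uniformly_continuous_on (closure (range f)) g"
    and gf: "\<And>z. z \<in> range f \<Longrightarrow> inv f z = g z"
    using uniformly_continuous_on_extension_on_closure by metis
  define J where "J z = indicator (closure (range f)) z *\<^sub>R g z" for z
  have "J \<in> borel_measurable borel"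
    unfolding J_def[abs_def]
    by (rule borel_measurable_continuous_on_indicator) (auto intro: uniformly_continuous_imp_continuous g)
  moreover have "J (f x) = x" for x
    using gf[of "f x"] closure_subset[of "range f"] by (auto simp: J_def \<open>inj f\<close> indicator_def)
  ultimately show ?thesis unfolding f_def by (intro bexI[of _ J]) auto
qed

text \<open>The coupling that displaces each point by its own forward step. Its cost is exactly the
  last term in the lower bound of \<open>W2_forward_step_ge\<close>, so the two cancel in the
  descent inequality.\<close>

lemma W2_forward_step_le:
  assumes \<mu>: "\<mu> \<in> P2"
  shows "(W2 (forward_step \<mu>) \<mu>)\<^sup>2 \<le> \<eta>\<^sup>2 * (\<integral>x. (norm (S x))\<^sup>2 \<partial>\<mu>)"
proof -
  note \<mu>D = P2D[OF \<mu>]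
  have m [measurable]: "(\<lambda>x. x) \<in> borel_measurable \<mu>" "S \<in> borel_measurable \<mu>"
    using \<mu>D(2) S_meas by (auto cong: measurable_cong_sets)
  define \<gamma> where "\<gamma> = distr \<mu> (borel \<Otimes>\<^sub>M borel) (\<lambda>x. (x + \<eta> *\<^sub>R S x, x))"
  have "distr \<mu> borel (\<lambda>x. x) = \<mu>" using \<mu>D(2) by (intro distr_id2) simp
  then have "\<gamma> \<in> couplings (forward_step \<mu>) \<mu>"
    using distr_in_couplings[OF \<mu>D(1), of "\<lambda>x. x + \<eta> *\<^sub>R S x" "\<lambda>x. x"]
    by (simp add: \<gamma>_def forward_step_def)
  then have "(W2 (forward_step \<mu>) \<mu>)\<^sup>2 \<le> transport_cost \<gamma>" by (rule W2_square_le)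
  also have "\<dots> = (\<integral>x. (norm (\<eta> *\<^sub>R S x))\<^sup>2 \<partial>\<mu>)"
    unfolding transport_cost_def \<gamma>_def by (subst integral_distr) auto
  also have "\<dots> = \<eta>\<^sup>2 * (\<integral>x. (norm (S x))\<^sup>2 \<partial>\<mu>)" by (simp add: power_mult_distrib)
  finally show ?thesis .
qed

lemma forward_step_P2:
  assumes \<mu>: "\<mu> \<in> P2"
  shows "forward_step \<mu> \<in> P2"
proof -
  note \<mu>D = P2D[OF \<mu>]
  have m [measurable]: "(\<lambda>x. x) \<in> borel_measurable \<mu>" "S \<in> borel_measurable \<mu>"
    using \<mu>D(2) S_meas by (auto cong: measurable_cong_sets)
  have "integrable \<mu> (\<lambda>x. (norm (x + \<eta> *\<^sub>R S x))\<^sup>2)"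
  proof (rule Bochner_Integration.integrable_bound)
    show "integrable \<mu> (\<lambda>x. 2 * (norm x)\<^sup>2 + 2 * (\<eta>\<^sup>2 * (norm (S x))\<^sup>2))"
      using \<mu>D(4) integrable_S_square[OF \<mu>] by simp
    have "(norm (x + \<eta> *\<^sub>R S x))\<^sup>2 \<le> 2 * (norm x)\<^sup>2 + 2 * (\<eta>\<^sup>2 * (norm (S x))\<^sup>2)" for x
      using norm_diff_square_le[of x "- (\<eta> *\<^sub>R S x)"] by (simp add: power_mult_distrib)
    then show "AE x in \<mu>. norm ((norm (x + \<eta> *\<^sub>R S x))\<^sup>2) \<le> norm (2 * (norm x)\<^sup>2 + 2 * (\<eta>\<^sup>2 * (norm (S x))\<^sup>2))"
      by (auto intro!: always_eventually)
  qed measurable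
  then have "integrable (forward_step \<mu>) (\<lambda>x. (norm x)\<^sup>2)"
    unfolding forward_step_def by (subst integrable_distr_eq) auto
  moreover have "prob_space (forward_step \<mu>)"
    unfolding forward_step_def by (intro prob_space.prob_space_distr \<mu>D(1)) measurable
  ultimately show ?thesis by (simp add: P2_def forward_step_def)
qed

lemma W2_forward_step_ge:
  assumes \<mu>: "\<mu> \<in> P2" and \<pi>: "\<pi> \<in> P2"
  shows "(W2 \<mu> \<pi>)\<^sup>2 + 2 * \<eta> * (potential_energy H \<mu> - potential_energy H \<pi>)
      + \<eta>\<^sup>2 * (\<integral>x. (norm (S x))\<^sup>2 \<partial>\<mu>) \<le> (W2 (forward_step \<mu>) \<pi>)\<^sup>2"
proof (rule W2_square_ge[OF couplings_nonempty[OF forward_step_P2[OF \<mu>] \<pi>]])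
  fix \<gamma> assume \<gamma>: "\<gamma> \<in> couplings (forward_step \<mu>) \<pi>"
  note \<gamma>D = couplingsD[OF \<gamma>] and \<mu>D = P2D[OF \<mu>]
  obtain J where [measurable]: "J \<in> borel_measurable borel" and J: "\<And>x. J (x + \<eta> *\<^sub>R S x) = x"
    using forward_inverse by blast
  have [measurable]: "fst \<in> borel_measurable \<gamma>" "snd \<in> borel_measurable \<gamma>"
    using \<gamma>D(2) by (auto cong: measurable_cong_sets simp: borel_prod[symmetric])
  have m [measurable]: "(\<lambda>x. x) \<in> borel_measurable \<mu>" "S \<in> borel_measurable \<mu>"
    using \<mu>D(2) S_meas by (auto cong: measurable_cong_sets)
  define \<gamma>' where "\<gamma>' = distr \<gamma> (borel \<Otimes>\<^sub>M borel) (\<lambda>z. (J (fst z), snd z))"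
  have "distr \<gamma> borel (\<lambda>z. J (fst z)) = distr (distr \<gamma> borel fst) borel J"
    by (simp add: distr_distr o_def)
  also have "\<dots> = distr \<mu> borel (\<lambda>x. x)"
    unfolding \<gamma>D(3) forward_step_def by (simp add: distr_distr o_def J)
  also have "\<dots> = \<mu>" using \<mu>D(2) by (intro distr_id2) simp
  finally have law: "distr \<gamma> borel (\<lambda>z. J (fst z)) = \<mu>" .
  have \<gamma>': "\<gamma>' \<in> couplings \<mu> \<pi>"
    using distr_in_couplings[OF \<gamma>D(1), of "\<lambda>z. J (fst z)" snd] law \<gamma>D(4) by (simp add: \<gamma>'_def)
  \<comment> \<open>\<open>J\<close> is known to invert the forward map on its range only; the first
    marginal of \<gamma> is an image under that map, which gives the identity almost
    everywhere.\<close>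
  have "AE z in distr \<gamma> borel fst. z = J z + \<eta> *\<^sub>R S (J z)"
    unfolding \<gamma>D(3) forward_step_def by (subst AE_distr_iff) (auto simp: J)
  then have inverse_AE: "AE z in \<gamma>. fst z = J (fst z) + \<eta> *\<^sub>R S (J (fst z))"
    by (subst (asm) AE_distr_iff) auto
  then have "transport_cost \<gamma> = (\<integral>z. (norm (J (fst z) + \<eta> *\<^sub>R S (J (fst z)) - snd z))\<^sup>2 \<partial>\<gamma>)"
    unfolding transport_cost_def by (intro integral_cong_AE) auto
  also have "\<dots> = (\<integral>z. (norm (fst z + \<eta> *\<^sub>R S (fst z) - snd z))\<^sup>2 \<partial>\<gamma>')"
    unfolding \<gamma>'_def by (subst integral_distr) auto
  finally have cost: "transport_cost \<gamma> = (\<integral>z. (norm (fst z + \<eta> *\<^sub>R S (fst z) - snd z))\<^sup>2 \<partial>\<gamma>')" .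
  \<comment> \<open>Apart from the squared distance, each term of \<open>lo\<close> depends on one
    coordinate only. Its integral is therefore the same for all couplings up to the transport cost,
    unlike that of the inner product it replaces.\<close>
  define lo where "lo z = (norm (fst z - snd z))\<^sup>2 + 2 * \<eta> * (H (fst z) - H (snd z)) + \<eta>\<^sup>2 * (norm (S (fst z)))\<^sup>2" for z
  have ints: "integrable \<gamma>' (\<lambda>z. (norm (fst z - snd z))\<^sup>2)" "integrable \<gamma>' (\<lambda>z. H (fst z))"
      "integrable \<gamma>' (\<lambda>z. H (snd z))" "integrable \<gamma>' (\<lambda>z. (norm (S (fst z)))\<^sup>2)"
    using integrable_cost[OF \<gamma>' \<mu> \<pi>] integrable_marginals(1)[OF \<gamma>' _ integrable_H[OF \<mu>]]
      integrable_marginals(2)[OF \<gamma>' _ integrable_H[OF \<pi>]]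
      integrable_marginals(1)[OF \<gamma>' _ integrable_S_square[OF \<mu>]] by auto
  have "(W2 \<mu> \<pi>)\<^sup>2 + 2 * \<eta> * (potential_energy H \<mu> - potential_energy H \<pi>)
      + \<eta>\<^sup>2 * (\<integral>x. (norm (S x))\<^sup>2 \<partial>\<mu>) \<le> transport_cost \<gamma>' + 2 * \<eta> * (potential_energy H \<mu> - potential_energy H \<pi>)
      + \<eta>\<^sup>2 * (\<integral>x. (norm (S x))\<^sup>2 \<partial>\<mu>)"
    using W2_square_le[OF \<gamma>'] by simp
  also have "\<dots> = (\<integral>z. lo z \<partial>\<gamma>')"
    unfolding lo_def transport_cost_def potential_energy_def
    using ints integrable_marginals(3)[OF \<gamma>', of H] integrable_marginals(4)[OF \<gamma>', of H]
      integrable_marginals(3)[OF \<gamma>', of "\<lambda>x. (norm (S x))\<^sup>2"] by simp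
  also have "\<dots> \<le> (\<integral>z. (norm (fst z + \<eta> *\<^sub>R S (fst z) - snd z))\<^sup>2 \<partial>\<gamma>')"
  proof (rule Bochner_Integration.integral_mono)
    show "integrable \<gamma>' lo" unfolding lo_def[abs_def] using ints by simp
    have sq: "(norm (x + \<eta> *\<^sub>R s - y))\<^sup>2 = (norm (x - y))\<^sup>2 + 2 * \<eta> * (s \<bullet> (x - y)) + \<eta>\<^sup>2 * (norm s)\<^sup>2"
      for x y s :: 'a
      unfolding power2_norm_eq_inner by (simp add: algebra_simps inner_commute power2_eq_square)
    show "lo z \<le> (norm (fst z + \<eta> *\<^sub>R S (fst z) - snd z))\<^sup>2" for z
    proof -
      have "H (fst z) + S (fst z) \<bullet> (snd z - fst z) \<le> H (snd z)"
        using S_sub[of "fst z"] by (auto simp: subdifferential_def)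
      then have "H (fst z) - H (snd z) \<le> S (fst z) \<bullet> (fst z - snd z)" by (simp add: inner_diff_right)
      then have "2 * \<eta> * (H (fst z) - H (snd z)) \<le> 2 * \<eta> * (S (fst z) \<bullet> (fst z - snd z))"
        using \<eta>_pos by (intro mult_left_mono) auto
      then show ?thesis unfolding lo_def sq by simp
    qed
    have "integrable \<gamma> (\<lambda>z. (norm (fst z - snd z))\<^sup>2)"
      by (rule integrable_cost[OF \<gamma> forward_step_P2[OF \<mu>] \<pi>])
    then have "integrable \<gamma> (\<lambda>z. (norm (J (fst z) + \<eta> *\<^sub>R S (J (fst z)) - snd z))\<^sup>2)"
    proof (rule integrable_cong_AE_imp)
      show "AE z in \<gamma>. (norm (fst z - snd z))\<^sup>2 = (norm (J (fst z) + \<eta> *\<^sub>R S (J (fst z)) - snd z))\<^sup>2"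
        using inverse_AE by eventually_elim simp
    qed measurable
    then show "integrable \<gamma>' (\<lambda>z. (norm (fst z + \<eta> *\<^sub>R S (fst z) - snd z))\<^sup>2)"
      unfolding \<gamma>'_def by (subst integrable_distr_eq) auto
  qed
  finally show "(W2 \<mu> \<pi>)\<^sup>2 + 2 * \<eta> * (potential_energy H \<mu> - potential_energy H \<pi>)
      + \<eta>\<^sup>2 * (\<integral>x. (norm (S x))\<^sup>2 \<partial>\<mu>) \<le> transport_cost \<gamma>" by (simp add: cost)
qed

text \<open>The minimizer is compared with the single competitor \<mu>, the current iterate.
  \<open>\<Phi>\<close> is real-valued, so the terms can be cancelled by ordinary arithmetic once
  infinite values have been excluded.\<close>

lemma forward_backward_descent:
  assumes \<mu>: "\<mu> \<in> P2" and \<pi>: "\<pi> \<in> P2"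
    and step: "\<Phi> \<pi> + 1 / (2 * \<eta>) * (W2 (forward_step \<mu>) \<pi>)\<^sup>2
      \<le> \<Phi> \<mu> + 1 / (2 * \<eta>) * (W2 (forward_step \<mu>) \<mu>)\<^sup>2"
  shows "(W2 \<mu> \<pi>)\<^sup>2 \<le> 2 * \<eta> * ((\<Phi> \<mu> - potential_energy H \<mu>) - (\<Phi> \<pi> - potential_energy H \<pi>))"
proof -
  have "2 * \<eta> * (\<Phi> \<pi> + 1 / (2 * \<eta>) * (W2 (forward_step \<mu>) \<pi>)\<^sup>2)
      \<le> 2 * \<eta> * (\<Phi> \<mu> + 1 / (2 * \<eta>) * (W2 (forward_step \<mu>) \<mu>)\<^sup>2)"
    using step \<eta>_pos by (intro mult_left_mono) auto
  then have "2 * \<eta> * \<Phi> \<pi> + (W2 (forward_step \<mu>) \<pi>)\<^sup>2 \<le> 2 * \<eta> * \<Phi> \<mu> + (W2 (forward_step \<mu>) \<mu>)\<^sup>2"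
    using \<eta>_pos by (simp add: distrib_left)
  then show ?thesis
    using W2_forward_step_le[OF \<mu>] W2_forward_step_ge[OF \<mu> \<pi>] by (simp add: algebra_simps)
qed

end

section \<open>The gradient mapping and the convergence rate\<close>

lemma L2_norm_gradient_mapping:
  assumes \<mu>: "\<mu> \<in> P2abs" and \<pi>: "\<pi> \<in> P2" and \<eta>: "0 < \<eta>"
  shows "(L2_norm_wrt \<mu> (gradient_mapping \<eta> \<mu> \<pi>))\<^sup>2 = (W2 \<mu> \<pi>)\<^sup>2 / \<eta>\<^sup>2"
proof -
  define T where "T = optimal_map \<mu> \<pi>"
  \<comment> \<open>The choice operator meets its specification only because some optimal map
    exists. The plan on the graph of \<open>T\<close> then realizes the Wasserstein distance,
    whichever version was chosen.\<close>
  have "is_optimal_map \<mu> \<pi> T"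
    unfolding T_def optimal_map_def using optimal_map_exists[OF \<mu> \<pi>] by (rule someI_ex)
  then have [measurable]: "T \<in> borel_measurable borel"
    and opt: "distr \<mu> (borel \<Otimes>\<^sub>M borel) (\<lambda>x. (x, T x)) \<in> optimal_plans \<mu> \<pi>"
    by (auto simp: is_optimal_map_def)
  have "\<mu> \<in> P2" using \<mu> by (simp add: P2abs_def)
  then have [measurable]: "(\<lambda>x. x) \<in> borel_measurable \<mu>" "T \<in> borel_measurable \<mu>"
    using P2D(2)[of \<mu>] by (auto cong: measurable_cong_sets)
  have "(W2 \<mu> \<pi>)\<^sup>2 = (\<integral>x. (norm (x - T x))\<^sup>2 \<partial>\<mu>)"
    unfolding optimal_plans_cost[OF opt, symmetric] transport_cost_def by (subst integral_distr) auto
  moreover have "(L2_norm_wrt \<mu> (gradient_mapping \<eta> \<mu> \<pi>))\<^sup>2 = (\<integral>x. (norm (x - T x))\<^sup>2 / \<eta>\<^sup>2 \<partial>\<mu>)"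
    unfolding L2_norm_wrt_def gradient_mapping_def T_def[symmetric]
    by (simp add: power_mult_distrib power_divide)
  ultimately show ?thesis by simp
qed

text \<open>A minimum is at most the average, and the sum telescopes to at most
  \<open>V 1 - c\<close>, which becomes the constant. All hypotheses start at index 1, since
  \<open>V 0\<close> may carry no information.\<close>

lemma Min_bigo_inverse_if_telescoping:
  fixes a V :: "nat \<Rightarrow> real"
  assumes nonneg: "\<And>n. 1 \<le> n \<Longrightarrow> 0 \<le> a n"
    and descent: "\<And>n. 1 \<le> n \<Longrightarrow> a n \<le> V n - V (Suc n)" and below: "\<And>n. 1 \<le> n \<Longrightarrow> c \<le> V n"
  shows "(\<lambda>N. MIN n\<in>{1..N}. a n) \<in> O(\<lambda>N. 1 / real N)"
proof (rule bigoI[of _ "V 1 - c"], rule eventually_mono[OF eventually_ge_at_top[of 1]])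
  fix N :: nat assume N: "1 \<le> N"
  define m where "m = (MIN n\<in>{1..N}. a n)"
  have fin: "finite (a ` {1..N})" "a ` {1..N} \<noteq> {}" using N by auto
  have "m \<in> a ` {1..N}" unfolding m_def by (rule Min_in[OF fin])
  then have "0 \<le> m" using nonneg by auto
  have "(\<Sum>n=1..N. a n) \<le> V 1 - V (Suc N)"
    using N
  proof (induction N rule: dec_induct)
    case base
    then show ?case using descent[of 1] by simp
  next
    case (step n)
    then show ?case using descent[of "Suc n"] by simp
  qed
  moreover have "(\<Sum>n=1..N. m) \<le> (\<Sum>n=1..N. a n)"
    unfolding m_def by (intro sum_mono Min_le) auto
  ultimately have "real N * m \<le> V 1 - c" using below[of "Suc N"] by simp
  then have "m \<le> (V 1 - c) / real N" using N by (simp add: field_simps)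
  then show "norm (MIN n\<in>{1..N}. a n) \<le> (V 1 - c) * norm (1 / real N)"
    using \<open>0 \<le> m\<close> by (simp add: m_def)
qed

theorem theorem2:
  fixes G H :: "real ^ 'd \<Rightarrow> real"
    and \<H> :: "(real ^ 'd) measure \<Rightarrow> ereal"
    and S :: "real ^ 'd \<Rightarrow> real ^ 'd"
    and \<mu> \<nu> :: "nat \<Rightarrow> (real ^ 'd) measure"
    and \<eta> \<eta>\<^sub>0 :: real
  assumes bounded_below: "\<exists>c::real. \<forall>\<rho>\<in>P2.
        ereal c \<le> ereal (potential_energy G \<rho>) - ereal (potential_energy H \<rho>) + \<H> \<rho>"
    and G: "convex_on UNIV G" "quadratic_growth G"
    and H: "convex_on UNIV H" "quadratic_growth H"
    and \<H>: "never_minus_infinity \<H>" "proper_functional \<H>" "lsc_W2 \<H>" "convex_along_gg \<H>"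
      "domain_of \<H> \<subseteq> P2abs"
    and \<eta>\<^sub>0: "0 < \<eta>\<^sub>0"
      "\<And>\<tau> \<rho>. 0 < \<tau> \<Longrightarrow> \<tau> < \<eta>\<^sub>0 \<Longrightarrow> \<rho> \<in> P2 \<Longrightarrow>
        JKO \<tau> (\<lambda>\<pi>. ereal (potential_energy G \<pi>) + \<H> \<pi>) \<rho> \<noteq> {}"
    and S: "S \<in> borel_measurable borel" "\<And>x. S x \<in> subdifferential H x"
    and \<eta>: "0 < \<eta>" "\<eta> < \<eta>\<^sub>0"
    and init: "\<mu> 0 \<in> P2abs"
    and forward: "\<And>n. \<nu> (Suc n) = distr (\<mu> n) borel (\<lambda>x. x + \<eta> *\<^sub>R S x)"
    and backward: "\<And>n. \<mu> (Suc n) \<in>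
        JKO \<eta> (\<lambda>\<pi>. ereal (potential_energy G \<pi>) + \<H> \<pi>) (\<nu> (Suc n))"
  shows "(\<lambda>N. MIN n\<in>{1..N}. (L2_norm_wrt (\<mu> n) (gradient_mapping \<eta> (\<mu> n) (\<mu> (Suc n))))\<^sup>2)
      \<in> O(\<lambda>N. 1 / real N)"
proof -
  interpret subgradient_selection H S \<eta>
    by unfold_locales (use H S \<eta> in auto)
  obtain c where c: "\<And>\<rho>. \<rho> \<in> P2 \<Longrightarrow>
      ereal c \<le> ereal (potential_energy G \<rho>) - ereal (potential_energy H \<rho>) + \<H> \<rho>"
    using bounded_below by auto
  have minimal: "ereal (potential_energy G (\<mu> (Suc n))) + \<H> (\<mu> (Suc n))
        + ereal (1 / (2 * \<eta>) * (W2 (forward_step (\<mu> n)) (\<mu> (Suc n)))\<^sup>2)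
      \<le> ereal (potential_energy G \<rho>) + \<H> \<rho> + ereal (1 / (2 * \<eta>) * (W2 (forward_step (\<mu> n)) \<rho>)\<^sup>2)"
    and P2_Suc: "\<mu> (Suc n) \<in> P2" if "\<rho> \<in> P2" for n \<rho>
    using backward[of n] that unfolding JKO_def is_arg_min_linorder forward_step_def forward by auto
  \<comment> \<open>A competitor of finite value forces every minimizer to have finite value, even
    when \<open>\<H> (\<mu> 0)\<close> is infinite.\<close>
  obtain \<rho> where \<rho>: "\<rho> \<in> P2" "\<H> \<rho> < \<infinity>"
    using \<H>(2) by (auto simp: proper_functional_def domain_of_def)
  have fin: "\<H> (\<mu> (Suc n)) < \<infinity>" for n
    using minimal[OF \<rho>(1), of n] \<rho>(2) by (cases "\<H> (\<mu> (Suc n))"; cases "\<H> \<rho>") auto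
  then have abs: "\<mu> n \<in> P2abs" if "1 \<le> n" for n
    using that \<H>(5) P2_Suc[OF \<rho>(1)] by (cases n) (auto simp: domain_of_def)
  \<comment> \<open>At n = 0 this may be the default 0 standing for an infinite value; it represents
    \<open>\<H> (\<mu> n)\<close> from n = 1 on.\<close>
  define h where "h n = real_of_ereal (\<H> (\<mu> n))" for n
  have h: "\<H> (\<mu> n) = ereal (h n)" if n: "1 \<le> n" for n
  proof -
    obtain k where "n = Suc k" using n by (cases n) auto
    then have "\<bar>\<H> (\<mu> n)\<bar> \<noteq> \<infinity>"
      using fin[of k] P2_Suc[OF \<rho>(1), of k] \<H>(1) by (auto simp: never_minus_infinity_def)
    then show ?thesis by (simp add: h_def ereal_real')
  qed
  \<comment> \<open>The descent inequality has the factor \<open>2 * \<eta>\<close>, and the squared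
    norm of the gradient mapping is the squared distance divided by \<open>\<eta>\<^sup>2\<close>;
    together they give \<open>2 / \<eta>\<close>.\<close>
  define V where "V n = 2 / \<eta> * (potential_energy G (\<mu> n) + h n - potential_energy H (\<mu> n))" for n
  show ?thesis
  proof (rule Min_bigo_inverse_if_telescoping)
    fix n :: nat assume n: "1 \<le> n"
    show "0 \<le> (L2_norm_wrt (\<mu> n) (gradient_mapping \<eta> (\<mu> n) (\<mu> (Suc n))))\<^sup>2" by simp
    have P2: "\<mu> n \<in> P2" using abs[OF n] by (simp add: P2abs_def)
    have "potential_energy G (\<mu> (Suc n)) + h (Suc n)
        + 1 / (2 * \<eta>) * (W2 (forward_step (\<mu> n)) (\<mu> (Suc n)))\<^sup>2
      \<le> potential_energy G (\<mu> n) + h n + 1 / (2 * \<eta>) * (W2 (forward_step (\<mu> n)) (\<mu> n))\<^sup>2"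
      using minimal[OF P2, of n] h[OF n] h[of "Suc n"] by simp
    then have "(W2 (\<mu> n) (\<mu> (Suc n)))\<^sup>2 \<le> 2 * \<eta> * ((potential_energy G (\<mu> n) + h n - potential_energy H (\<mu> n))
        - (potential_energy G (\<mu> (Suc n)) + h (Suc n) - potential_energy H (\<mu> (Suc n))))"
      using forward_backward_descent[OF P2 P2_Suc[OF \<rho>(1)], of
          "\<lambda>\<pi>. potential_energy G \<pi> + real_of_ereal (\<H> \<pi>)" n] by (simp add: h_def)
    then have "(W2 (\<mu> n) (\<mu> (Suc n)))\<^sup>2 / \<eta>\<^sup>2 \<le> (2 * \<eta> * ((potential_energy G (\<mu> n) + h n - potential_energy H (\<mu> n))
        - (potential_energy G (\<mu> (Suc n)) + h (Suc n) - potential_energy H (\<mu> (Suc n))))) / \<eta>\<^sup>2"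
      by (intro divide_right_mono) auto
    also have "\<dots> = V n - V (Suc n)"
      using \<eta>(1) by (simp add: V_def power2_eq_square field_simps)
    finally show "(L2_norm_wrt (\<mu> n) (gradient_mapping \<eta> (\<mu> n) (\<mu> (Suc n))))\<^sup>2 \<le> V n - V (Suc n)"
      using L2_norm_gradient_mapping[OF abs[OF n] P2_Suc[OF \<rho>(1)] \<eta>(1)] by simp
    show "2 / \<eta> * c \<le> V n"
      unfolding V_def using c[OF P2] h[OF n] \<eta>(1) by (intro mult_left_mono) auto
  qed
qed

end
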